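(* Let $K$ be a semi-Eberlein compact space with weight $\kappa$. Then there exists a continuous inverse system of compact spaces $\mathbb S=\big((K_\alpha)_{\alpha\in\kappa},(r_\alpha^\beta)_{\alpha\le\beta}\big)$, indexed by the ordinals $\alpha\in\kappa$, such that $K$ is the inverse limit of $\mathbb S$, each bonding map $r_\alpha^\beta:K_\beta\to K_\alpha$ is a retraction, and each $K_\alpha$ is semi-Eberlein with weight $w(K_\alpha)\le\max(\omega,|\alpha|)$.
   Context: All topological spaces are assumed Hausdorff. Semi-Eberlein: for a set $\Gamma$ let $c_0(\Gamma)=\{x\in\mathbb R^\Gamma: \text{for every }\varepsilon>0 \text{ the set } \{\gamma\in\Gamma:|x(\gamma)|>\varepsilon\}\text{ is finite}\}\subset\mathbb R^\Gamma$, where $\mathbb R^\Gamma$ has the product topology. A compact space $K$ is semi-Eberlein if there are a set $\Gamma$ and a homeomorphic embedding $h:K\to\mathbb R^\Gamma$ such that $h^{-1}[c_0(\Gamma)]$ is dense in $K$. Inverse systems: an inverse system of compact spaces indexed by an up-directed partially ordered set $\Sigma$ is a pair $\mathbb S=\big((K_s)_{s\in\Sigma},(p_s^t)_{s\le t}\big)$ where each $K_s$ is compact, each bonding map $p_s^t:K_t\to K_s$ ($s\le t$) is continuous, $p_s^s=\mathrm{id}_{K_s}$, and $p_{s_1}^{s_3}=p_{s_1}^{s_2}\circ p_{s_2}^{s_3}$ whenever $s_1\le s_2\le s_3$. Bonding maps are always assumed to be onto. A cone over $\mathbb S$ is a pair $(K,(p_s)_{s\in\Sigma})$ with $K$ compact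 and $p_s:K\to K_s$ continuous maps (projections) with $p_s=p_s^t\circ p_t$ for $s\le t$. An inverse limit of $\mathbb S$ is a cone $(K,(p_s)_{s\in\Sigma})$ such that for every cone $(L,(q_s)_{s\in\Sigma})$ there is a unique continuous $f:L\to K$ with $q_s=p_s\circ f$ for all $s\in\Sigma$; a space $K$ is said to be the inverse limit of $\mathbb S$ if there are projections making it so. For an up-directed $T\subset\Sigma$, $\mathbb S|_T$ denotes the restriction of $\mathbb S$ to indices in $T$. $\mathbb S$ is continuous if for every (nonempty) up-directed $T\subset\Sigma$ admitting a supremum $t=\sup T$ in $\Sigma$, $\big(K_t,(p_s^t)_{s\in T}\big)$ is the inverse limit of $\mathbb S|_T$. A retraction $r:X\to Y$ between topological spaces is a continuous map admitting a continuous right inverse $i:Y\to X$ (i.e. $r\circ i=\mathrm{id}_Y$). *)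

theory Defs
  imports "HOL-Analysis.Analysis"
begin

unbundle cardinal_syntax

definition compact_Hausdorff :: "'a topology \<Rightarrow> bool" where
  "compact_Hausdorff X \<longleftrightarrow> compact_space X \<and> Hausdorff_space X"


definition c0 :: "'g set \<Rightarrow> ('g \<Rightarrow> real) set" where
  "c0 \<Gamma> = {x \<in> topspace (powertop_real \<Gamma>). \<forall>\<epsilon>>0. finite {\<gamma>\<in>\<Gamma>. \<bar>x \<gamma>\<bar> > \<epsilon>}}"

text \<open>
  The type argument is the type from which the index set \<open>\<Gamma>\<close> is taken. As a hypothesis with a
  type variable it allows arbitrary index sets.
\<close>

definition semi_Eberlein :: "'g itself \<Rightarrow> 'a topology \<Rightarrow> bool" where
  "semi_Eberlein (_ :: 'g itself) K \<longleftrightarrow>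
     compact_Hausdorff K \<and>
     (\<exists>(\<Gamma> :: 'g set) h. embedding_map K (powertop_real \<Gamma>) h \<and>
        K closure_of {x \<in> topspace K. h x \<in> c0 \<Gamma>} = topspace K)"


definition topology_base :: "'a topology \<Rightarrow> 'a set set \<Rightarrow> bool" where
  "topology_base X \<B> \<longleftrightarrow> (\<forall>V\<in>\<B>. openin X V) \<and>
     (\<forall>U x. openin X U \<and> x \<in> U \<longrightarrow> (\<exists>V\<in>\<B>. x \<in> V \<and> V \<subseteq> U))"

text \<open>
  The weight is the least cardinality of a base. Cardinals are well-order relations and are only
  compared by \<open>\<le>o\<close> and \<open>=o\<close>, so it does not matter which smallest base is chosen.
\<close>

definition weight :: "'a topology \<Rightarrow> 'a set rel" where
  "weight X = |SOME \<B>. topology_base X \<B> \<and> (\<forall>\<B>'. topology_base X \<B>' \<longrightarrow> |\<B>| \<le>o |\<B>'| )|"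

lemma weight_attained:
  "\<exists>\<B>. topology_base X \<B> \<and> weight X = |\<B>| \<and> (\<forall>\<B>'. topology_base X \<B>' \<longrightarrow> |\<B>| \<le>o |\<B>'| )"
proof -
  have "topology_base X {U. openin X U}"
    unfolding topology_base_def by blast
  then have "card_of ` {\<B>. topology_base X \<B>} \<noteq> {}"
    by blast
  moreover have "\<forall>r \<in> card_of ` {\<B>. topology_base X \<B>}. Card_order r"
    by (auto simp: card_of_Card_order)
  ultimately have "\<exists>r \<in> card_of ` {\<B>. topology_base X \<B>}.
      \<forall>r' \<in> card_of ` {\<B>. topology_base X \<B>}. r \<le>o r'"
    by (rule exists_minim_Card_order)
  then have "\<exists>\<B>. topology_base X \<B> \<and> (\<forall>\<B>'. topology_base X \<B>' \<longrightarrow> |\<B>| \<le>o |\<B>'| )"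
    by auto
  from someI_ex[OF this] show ?thesis
    unfolding weight_def by blast
qed


text \<open>
  A partially ordered index set \<open>\<Sigma>\<close> is represented by its order relation \<open>R\<close>, with
  \<open>\<Sigma> = Field R\<close>. In \<open>p s t\<close> the bonding map goes from \<open>K t\<close> to \<open>K s\<close>. The restriction of a system
  to \<open>T \<subseteq> \<Sigma>\<close> is given by the same families over \<open>Restr R T\<close>.
\<close>

definition up_directed :: "'i rel \<Rightarrow> 'i set \<Rightarrow> bool" where
  "up_directed R T \<longleftrightarrow> T \<noteq> {} \<and> T \<subseteq> Field R \<and>
     (\<forall>s\<in>T. \<forall>t\<in>T. \<exists>u\<in>T. (s, u) \<in> R \<and> (t, u) \<in> R)"

definition is_supremum :: "'i rel \<Rightarrow> 'i set \<Rightarrow> 'i \<Rightarrow> bool" where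
  "is_supremum R T t \<longleftrightarrow> t \<in> Above R T \<and> (\<forall>u \<in> Above R T. (t, u) \<in> R)"

definition inverse_system ::
    "'i rel \<Rightarrow> ('i \<Rightarrow> 'a topology) \<Rightarrow> ('i \<Rightarrow> 'i \<Rightarrow> 'a \<Rightarrow> 'a) \<Rightarrow> bool" where
  "inverse_system R K p \<longleftrightarrow>
     Partial_order R \<and> up_directed R (Field R) \<and>
     (\<forall>s\<in>Field R. compact_Hausdorff (K s)) \<and>
     (\<forall>(s, t)\<in>R. continuous_map (K t) (K s) (p s t) \<and>
                  p s t ` topspace (K t) = topspace (K s)) \<and>
     (\<forall>s\<in>Field R. \<forall>x\<in>topspace (K s). p s s x = x) \<and>
     (\<forall>s t u. (s, t) \<in> R \<and> (t, u) \<in> R \<longrightarrow>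
        (\<forall>x\<in>topspace (K u). p s u x = p s t (p t u x)))"

definition system_cone ::
    "'i rel \<Rightarrow> ('i \<Rightarrow> 'a topology) \<Rightarrow> ('i \<Rightarrow> 'i \<Rightarrow> 'a \<Rightarrow> 'a) \<Rightarrow>
     'l topology \<Rightarrow> ('i \<Rightarrow> 'l \<Rightarrow> 'a) \<Rightarrow> bool" where
  "system_cone R K p L q \<longleftrightarrow>
     compact_Hausdorff L \<and>
     (\<forall>s\<in>Field R. continuous_map L (K s) (q s)) \<and>
     (\<forall>(s, t)\<in>R. \<forall>x\<in>topspace L. q s x = p s t (q t x))"

definition cone_morphism ::
    "'i rel \<Rightarrow> 'l topology \<Rightarrow> ('i \<Rightarrow> 'l \<Rightarrow> 'a) \<Rightarrow>
     'b topology \<Rightarrow> ('i \<Rightarrow> 'b \<Rightarrow> 'a) \<Rightarrow> ('l \<Rightarrow> 'b) \<Rightarrow> bool" where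
  "cone_morphism R L q X \<pi> f \<longleftrightarrow>
     continuous_map L X f \<and> (\<forall>s\<in>Field R. \<forall>x\<in>topspace L. q s x = \<pi> s (f x))"

text \<open>
  The universal property of an inverse limit, for cones whose vertex has carrier type \<open>'l\<close>.
  Maps are total functions of which only the values on the domain matter, hence the form of
  the uniqueness clause.
\<close>

definition inverse_limit_wrt ::
    "'l itself \<Rightarrow> 'i rel \<Rightarrow> ('i \<Rightarrow> 'a topology) \<Rightarrow> ('i \<Rightarrow> 'i \<Rightarrow> 'a \<Rightarrow> 'a) \<Rightarrow>
     'b topology \<Rightarrow> ('i \<Rightarrow> 'b \<Rightarrow> 'a) \<Rightarrow> bool" where
  "inverse_limit_wrt (_ :: 'l itself) R K p X \<pi> \<longleftrightarrow>
     system_cone R K p X \<pi> \<and>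
     (\<forall>(L :: 'l topology) q. system_cone R K p L q \<longrightarrow>
        (\<exists>f. cone_morphism R L q X \<pi> f \<and>
           (\<forall>g. cone_morphism R L q X \<pi> g \<longrightarrow> (\<forall>x\<in>topspace L. g x = f x))))"

text \<open>
  A definition cannot quantify over all types, so the test cones are taken over the type
  \<open>'i \<Rightarrow> 'a\<close> of threads; lemma \<open>inverse_limit_universal\<close> shows that the universal property then
  holds for cones over every type.
\<close>

definition inverse_limit ::
    "'i rel \<Rightarrow> ('i \<Rightarrow> 'a topology) \<Rightarrow> ('i \<Rightarrow> 'i \<Rightarrow> 'a \<Rightarrow> 'a) \<Rightarrow>
     'b topology \<Rightarrow> ('i \<Rightarrow> 'b \<Rightarrow> 'a) \<Rightarrow> bool" where
  "inverse_limit R K p X \<pi> \<longleftrightarrow> inverse_limit_wrt TYPE('i \<Rightarrow> 'a) R K p X \<pi>"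

definition continuous_inverse_system ::
    "'i rel \<Rightarrow> ('i \<Rightarrow> 'a topology) \<Rightarrow> ('i \<Rightarrow> 'i \<Rightarrow> 'a \<Rightarrow> 'a) \<Rightarrow> bool" where
  "continuous_inverse_system R K p \<longleftrightarrow>
     inverse_system R K p \<and>
     (\<forall>T t. up_directed R T \<and> is_supremum R T t \<longrightarrow>
        inverse_limit (Restr R T) K p (K t) (\<lambda>s. p s t))"


lemma inverse_system_Restr:
  assumes sys: "inverse_system R K p" and T: "up_directed R T"
  shows "Field (Restr R T) = T" and "inverse_system (Restr R T) K p"
proof -
  have R: "Partial_order R" using sys by (simp add: inverse_system_def)
  have TF: "T \<subseteq> Field R" using T by (simp add: up_directed_def)
  show F: "Field (Restr R T) = T"
    using R TF by (simp add: partial_order_on_def preorder_on_def Refl_Field_Restr2)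
  have po: "Partial_order (Restr R T)"
    by (rule Partial_order_Restr[OF R])
  have dir: "up_directed (Restr R T) T"
    unfolding up_directed_def F
  proof (intro conjI ballI)
    fix s t assume st: "s \<in> T" "t \<in> T"
    then obtain u where "u \<in> T" "(s, u) \<in> R" "(t, u) \<in> R"
      using T unfolding up_directed_def by blast
    with st show "\<exists>u\<in>T. (s, u) \<in> Restr R T \<and> (t, u) \<in> Restr R T" by blast
  qed (use T in \<open>auto simp: up_directed_def\<close>)
  show "inverse_system (Restr R T) K p"
    unfolding inverse_system_def F
  proof (intro conjI)
    show "\<forall>s\<in>T. compact_Hausdorff (K s)"
      using sys TF unfolding inverse_system_def by blast
    show "\<forall>(s, t)\<in>Restr R T. continuous_map (K t) (K s) (p s t) \<and>
                  p s t ` topspace (K t) = topspace (K s)"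
      using sys unfolding inverse_system_def by auto
    show "\<forall>s\<in>T. \<forall>x\<in>topspace (K s). p s s x = x"
      using sys TF unfolding inverse_system_def by blast
    have "\<forall>s t u. (s, t) \<in> R \<and> (t, u) \<in> R \<longrightarrow>
        (\<forall>x\<in>topspace (K u). p s u x = p s t (p t u x))"
      using sys unfolding inverse_system_def by (elim conjE)
    then show "\<forall>s t u. (s, t) \<in> Restr R T \<and> (t, u) \<in> Restr R T \<longrightarrow>
        (\<forall>x\<in>topspace (K u). p s u x = p s t (p t u x))"
      by (meson IntD1)
  qed (use po dir F in simp_all)
qed

lemma inverse_limit_universal:
  fixes R :: "'i rel" and K :: "'i \<Rightarrow> 'a topology" and X :: "'b topology"
  assumes sys: "inverse_system R K p" and lim: "inverse_limit R K p X \<pi>"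
  shows "inverse_limit_wrt TYPE('l) R K p X \<pi>"
proof -
  have K: "\<And>s. s \<in> Field R \<Longrightarrow> compact_space (K s) \<and> Hausdorff_space (K s)"
    and p: "\<And>s t. (s, t) \<in> R \<Longrightarrow> continuous_map (K t) (K s) (p s t)"
    using sys by (auto simp: inverse_system_def compact_Hausdorff_def)
  have cX: "system_cone R K p X \<pi>"
    and univ: "\<And>(L :: ('i \<Rightarrow> 'a) topology) q. system_cone R K p L q \<Longrightarrow>
        \<exists>f. cone_morphism R L q X \<pi> f \<and>
           (\<forall>g. cone_morphism R L q X \<pi> g \<longrightarrow> (\<forall>x\<in>topspace L. g x = f x))"
    using lim by (auto simp: inverse_limit_def inverse_limit_wrt_def)
  define P where "P = product_topology K (Field R)"
  define E where "E = topspace P \<inter> (\<Inter>(s, t)\<in>R. {x \<in> topspace P. x s = p s t (x t)})"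
  define M where "M = subtopology P E"
  have proj: "continuous_map P (K s) (\<lambda>x. x s)" if "s \<in> Field R" for s
    unfolding P_def using that by (rule continuous_map_product_projection)
  have comp_P: "compact_space P"
    unfolding P_def compact_space_product_topology using K by blast
  have haus_P: "Hausdorff_space P"
    unfolding P_def Hausdorff_space_product_topology using K by blast
  have cl: "closedin P {x \<in> topspace P. x s = p s t (x t)}" if st: "(s, t) \<in> R" for s t
  proof (rule closedin_continuous_maps_eq[where Y = "K s"])
    have s: "s \<in> Field R" and t: "t \<in> Field R" using st by (auto simp: Field_def)
    show "Hausdorff_space (K s)" using K s by blast
    show "continuous_map P (K s) (\<lambda>x. x s)" using proj s .
    show "continuous_map P (K s) (\<lambda>x. p s t (x t))"
      using continuous_map_compose[OF proj[OF t] p[OF st]] by (simp add: o_def)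
  qed
  have "closedin P E"
    unfolding E_def
  proof (cases "R = {}")
    case False
    then have "closedin P (\<Inter>(s, t)\<in>R. {x \<in> topspace P. x s = p s t (x t)})"
      using cl by (intro closedin_Inter) auto
    then show "closedin P (topspace P \<inter> (\<Inter>(s, t)\<in>R. {x \<in> topspace P. x s = p s t (x t)}))"
      by (intro closedin_Int) auto
  qed auto
  then have "compact_space M"
    unfolding M_def using comp_P closedin_compact_space compact_space_subtopology by blast
  moreover have "Hausdorff_space M"
    unfolding M_def by (rule Hausdorff_space_subtopology[OF haus_P])
  moreover have topM: "topspace M = E"
    unfolding M_def E_def by auto
  ultimately have cM: "system_cone R K p M (\<lambda>s x. x s)"
    unfolding system_cone_def compact_Hausdorff_def
  proof (intro conjI ballI)
    show "continuous_map M (K s) (\<lambda>x. x s)" if "s \<in> Field R" for s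
      unfolding M_def using proj[OF that] by (rule continuous_map_from_subtopology)
    fix st assume st: "st \<in> R"
    then show "case st of (s, t) \<Rightarrow> \<forall>x\<in>topspace M. x s = p s t (x t)"
      unfolding topM E_def by blast
  qed
  obtain f where f: "cone_morphism R M (\<lambda>s x. x s) X \<pi> f"
    using univ[OF cM] by blast
  have sep: "x = y" if x: "x \<in> topspace X" and y: "y \<in> topspace X"
    and eq: "\<And>s. s \<in> Field R \<Longrightarrow> \<pi> s x = \<pi> s y" for x y
  proof -
    let ?pt = "discrete_topology {undefined :: 'i \<Rightarrow> 'a}"
    let ?q = "\<lambda>s (_ :: 'i \<Rightarrow> 'a). \<pi> s x"
    have \<pi>x: "\<pi> s x \<in> topspace (K s)" if "s \<in> Field R" for s
      using cX x that unfolding system_cone_def by (meson continuous_map_image_subset_topspace image_subset_iff)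
    have "system_cone R K p ?pt ?q"
      using cX x \<pi>x unfolding system_cone_def compact_Hausdorff_def
      by (auto simp: compact_space_discrete_topology Hausdorff_space_discrete_topology)
    from univ[OF this] obtain h where
      "\<forall>g. cone_morphism R ?pt ?q X \<pi> g \<longrightarrow> (\<forall>z\<in>topspace ?pt. g z = h z)"
      by (elim exE conjE)
    then have h: "g undefined = h undefined" if "cone_morphism R ?pt ?q X \<pi> g" for g
      using that by simp
    have "cone_morphism R ?pt ?q X \<pi> (\<lambda>_. x)" "cone_morphism R ?pt ?q X \<pi> (\<lambda>_. y)"
      using x y eq by (auto simp: cone_morphism_def)
    from h[OF this(1)] h[OF this(2)] show "x = y" by simp
  qed
  have "\<exists>f. cone_morphism R L q X \<pi> f \<and>
           (\<forall>g. cone_morphism R L q X \<pi> g \<longrightarrow> (\<forall>x\<in>topspace L. g x = f x))"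
    if cL: "system_cone R K p L q" for L :: "'l topology" and q
  proof -
    define e where "e = (\<lambda>x. \<lambda>s\<in>Field R. q s x)"
    have q: "\<And>s. s \<in> Field R \<Longrightarrow> continuous_map L (K s) (q s)"
      and qq: "\<And>s t x. (s, t) \<in> R \<Longrightarrow> x \<in> topspace L \<Longrightarrow> q s x = p s t (q t x)"
      using cL by (auto simp: system_cone_def)
    have eP: "continuous_map L P e"
      unfolding P_def continuous_map_componentwise e_def
    proof (intro conjI ballI)
      show "(\<lambda>x. \<lambda>s\<in>Field R. q s x) ` topspace L \<subseteq> extensional (Field R)" by auto
      fix k assume k: "k \<in> Field R"
      then show "continuous_map L (K k) (\<lambda>x. (\<lambda>s\<in>Field R. q s x) k)"
        using q[OF k] by simp
    qed
    have "e ` topspace L \<subseteq> E"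
    proof
      fix y assume "y \<in> e ` topspace L"
      then obtain x where x: "x \<in> topspace L" and y: "y = e x" by blast
      have "e x \<in> topspace P"
        using continuous_map_image_subset_topspace[OF eP] x by blast
      moreover have "e x s = p s t (e x t)" if "(s, t) \<in> R" for s t
        using qq[OF that x] that by (auto simp: e_def FieldI1 FieldI2)
      ultimately show "y \<in> E" unfolding E_def y by blast
    qed
    then have eM: "continuous_map L M e"
      unfolding M_def using eP by (auto intro: continuous_map_into_subtopology)
    have m: "cone_morphism R L q X \<pi> (f \<circ> e)"
      unfolding cone_morphism_def
    proof (intro conjI ballI)
      show "continuous_map L X (f \<circ> e)"
        using eM f continuous_map_compose unfolding cone_morphism_def by blast
      fix s x assume s: "s \<in> Field R" and x: "x \<in> topspace L"
      have "e x \<in> topspace M"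
        using continuous_map_image_subset_topspace[OF eM] x by blast
      then have "e x s = \<pi> s (f (e x))"
        using f s by (simp add: cone_morphism_def)
      then show "q s x = \<pi> s ((f \<circ> e) x)"
        using s by (simp add: e_def)
    qed
    have "g x = (f \<circ> e) x" if g: "cone_morphism R L q X \<pi> g" and x: "x \<in> topspace L" for g x
    proof (rule sep)
      show "g x \<in> topspace X" "(f \<circ> e) x \<in> topspace X"
        using g m x unfolding cone_morphism_def
        by (meson continuous_map_image_subset_topspace image_subset_iff)+
      fix s assume "s \<in> Field R"
      then show "\<pi> s (g x) = \<pi> s ((f \<circ> e) x)"
        using g m x unfolding cone_morphism_def by metis
    qed
    then show ?thesis using m by blast
  qed
  then show ?thesis
    unfolding inverse_limit_wrt_def using cX by blast
qed

end

theory Submission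
  imports Defs
begin

text \<open>
  Regard \<open>K\<close> as a subspace of \<open>\<real>\<^sup>\<Gamma>\<close> in which \<open>K \<inter> c\<^sub>0(\<Gamma>)\<close> is dense. Call \<open>S \<subseteq> \<Gamma>\<close> admissible if \<open>K\<close> is
  invariant under \<open>x \<mapsto> x \<cdot> 1\<^sub>S\<close>; this map is then a retraction of \<open>K\<close> onto the points of \<open>K\<close>
  supported in \<open>S\<close>, again a semi-Eberlein space, of weight at most \<open>max(\<omega>, |S|)\<close>. Since points of
  \<open>c\<^sub>0(\<Gamma>)\<close> have countable support, every set closed under a suitable finitary operator with
  countable values is admissible. The closures of an increasing continuous chain of sets of
  coordinates, whose union is a family of at most \<open>\<kappa>\<close> coordinates separating the points of \<open>K\<close>,
  therefore give the desired inverse system. When \<open>\<kappa>\<close> is finite the constant chain is used, because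
  \<open>\<kappa>\<close> then has a last element.
\<close>

subsection \<open>Cardinality and finitary closure operators\<close>

lemma countable_ordLeq_infinite:
  assumes "countable A" "infinite B"
  shows "|A| \<le>o |B|"
proof -
  have "|A| \<le>o |UNIV :: nat set|"
    using assms(1) unfolding countable_def card_of_ordLeq[symmetric] by auto
  also have "|UNIV :: nat set| \<le>o |B|"
    using assms(2) infinite_iff_card_of_nat by blast
  finally show ?thesis .
qed

text \<open>The finite subsets split by size into countably many layers. A set in layer
  \<open>Suc n\<close> arises by inserting one point into a set in layer \<open>n\<close>, so
  induction and the absorption of products by an infinite cardinal bound every layer, and then their
  union.\<close>

lemma card_of_Fpow_ordLeq_infinite:
  assumes inf: "infinite B" and A: "|A| \<le>o |B|"
  shows "|Fpow A| \<le>o |B|"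
proof -
  define P where "P n = {F \<in> Fpow A. card F = n}" for n
  have P: "|P n| \<le>o |B|" for n
  proof (induction n)
    case 0
    have "P 0 \<subseteq> {{}}"
      by (auto simp: P_def Fpow_def)
    then have "countable (P 0)"
      by (rule countable_subset) simp
    then show ?case
      by (rule countable_ordLeq_infinite) (rule inf)
  next
    case (Suc n)
    have "P (Suc n) \<subseteq> (\<lambda>(a, F). insert a F) ` (A \<times> P n)"
    proof
      fix F assume F: "F \<in> P (Suc n)"
      then obtain a G where "F = insert a G" "a \<notin> G" "card G = n"
        by (auto simp: P_def card_Suc_eq)
      with F show "F \<in> (\<lambda>(a, F). insert a F) ` (A \<times> P n)"
        by (auto simp: P_def Fpow_def intro!: image_eqI[of _ _ "(a, G)"])
    qed
    then have "|P (Suc n)| \<le>o |A \<times> P n|"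
      by (rule surj_imp_ordLeq)
    also have "|A \<times> P n| \<le>o |B|"
      using inf A Suc by (intro card_of_Times_ordLeq_infinite_Field) (simp_all add: Field_card_of card_of_card_order_on card_of_Card_order)
    finally show ?case .
  qed
  have "Fpow A = (\<Union>n\<in>UNIV. P n)"
    by (auto simp: P_def)
  then show ?thesis
    using card_of_UNION_ordLeq_infinite[OF inf, of "UNIV :: nat set" P] P inf
      countable_ordLeq_infinite[of "UNIV :: nat set" B] by simp
qed

text \<open>The operator is applied to whole finite sets, with countable values in mind. Finiteness
  of the arguments makes the closure commute with directed unions; countability of the values keeps
  it from outgrowing an infinite cardinal.\<close>

inductive_set finitary_closure :: "('a set \<Rightarrow> 'a set) \<Rightarrow> 'a set \<Rightarrow> 'a set"
  for \<phi> A where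
  base: "x \<in> A \<Longrightarrow> x \<in> finitary_closure \<phi> A"
| step: "finite F \<Longrightarrow> (\<And>y. y \<in> F \<Longrightarrow> y \<in> finitary_closure \<phi> A) \<Longrightarrow> x \<in> \<phi> F \<Longrightarrow> x \<in> finitary_closure \<phi> A"

lemma finitary_closure_subset: "A \<subseteq> finitary_closure \<phi> A"
  by (auto intro: finitary_closure.base)

lemma finitary_closure_closed:
  "finite F \<Longrightarrow> F \<subseteq> finitary_closure \<phi> A \<Longrightarrow> \<phi> F \<subseteq> finitary_closure \<phi> A"
  by (auto intro: finitary_closure.step)

lemma finitary_closure_least:
  assumes "A \<subseteq> S" and "\<And>F. finite F \<Longrightarrow> F \<subseteq> S \<Longrightarrow> \<phi> F \<subseteq> S"
  shows "finitary_closure \<phi> A \<subseteq> S"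
proof
  fix x assume "x \<in> finitary_closure \<phi> A"
  then show "x \<in> S"
  proof induction
    case (step F x)
    then have "F \<subseteq> S" by blast
    with assms(2) step show ?case by blast
  qed (use assms in blast)
qed

lemma finitary_closure_mono: "A \<subseteq> B \<Longrightarrow> finitary_closure \<phi> A \<subseteq> finitary_closure \<phi> B"
  by (rule finitary_closure_least[OF order_trans[OF _ finitary_closure_subset] finitary_closure_closed])

lemma finite_subset_directed_UN:
  assumes "T \<noteq> {}" and dir: "\<And>s t. s \<in> T \<Longrightarrow> t \<in> T \<Longrightarrow> \<exists>u\<in>T. S s \<subseteq> S u \<and> S t \<subseteq> S u"
    and "finite F" "F \<subseteq> (\<Union>s\<in>T. S s)"
  shows "\<exists>s\<in>T. F \<subseteq> S s"
  using assms(3,4)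
proof (induction F)
  case empty
  then show ?case using \<open>T \<noteq> {}\<close> by blast
next
  case (insert x F)
  then obtain s t where "s \<in> T" "F \<subseteq> S s" "t \<in> T" "x \<in> S t"
    by auto
  with dir[of s t] show ?case by blast
qed

text \<open>A finite set inside a directed union lies in a single member, so the union of the
  closures is already closed under \<open>\<phi>\<close>. This is the source of continuity of the
  inverse system at suprema.\<close>

lemma finitary_closure_directed_UN:
  assumes "T \<noteq> {}" and dir: "\<And>s t. s \<in> T \<Longrightarrow> t \<in> T \<Longrightarrow> \<exists>u\<in>T. A s \<subseteq> A u \<and> A t \<subseteq> A u"
  shows "finitary_closure \<phi> (\<Union>s\<in>T. A s) = (\<Union>s\<in>T. finitary_closure \<phi> (A s))"
proof
  have dir': "\<exists>u\<in>T. finitary_closure \<phi> (A s) \<subseteq> finitary_closure \<phi> (A u) \<and>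
      finitary_closure \<phi> (A t) \<subseteq> finitary_closure \<phi> (A u)" if st: "s \<in> T" "t \<in> T" for s t
  proof -
    obtain u where "u \<in> T" "A s \<subseteq> A u" "A t \<subseteq> A u"
      using dir[OF st] by blast
    then show ?thesis
      by (intro bexI[of _ u] conjI finitary_closure_mono)
  qed
  show "finitary_closure \<phi> (\<Union>s\<in>T. A s) \<subseteq> (\<Union>s\<in>T. finitary_closure \<phi> (A s))"
  proof (rule finitary_closure_least)
    show "(\<Union>s\<in>T. A s) \<subseteq> (\<Union>s\<in>T. finitary_closure \<phi> (A s))"
      by (rule UN_mono[OF order_refl finitary_closure_subset])
    fix F assume F: "finite F" "F \<subseteq> (\<Union>s\<in>T. finitary_closure \<phi> (A s))"
    obtain s where "s \<in> T" "F \<subseteq> finitary_closure \<phi> (A s)"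
      using finite_subset_directed_UN[OF \<open>T \<noteq> {}\<close> dir' F] by blast
    then show "\<phi> F \<subseteq> (\<Union>s\<in>T. finitary_closure \<phi> (A s))"
      using finitary_closure_closed[OF F(1), of \<phi> "A s"] by blast
  qed
  show "(\<Union>s\<in>T. finitary_closure \<phi> (A s)) \<subseteq> finitary_closure \<phi> (\<Union>s\<in>T. A s)"
    by (intro UN_least finitary_closure_mono UN_upper)
qed

text \<open>The closure is exhausted after \<omega> rounds: a finite subset of the union lies in
  some stage \<open>X n\<close>, and its value is added at stage \<open>Suc n\<close>. Each round
  adds countably many points for each finite subset, which an infinite cardinal absorbs.\<close>

lemma card_of_finitary_closure:
  assumes inf: "infinite B" and A: "|A| \<le>o |B|" and \<phi>: "\<And>F. countable (\<phi> F)"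
  shows "|finitary_closure \<phi> A| \<le>o |B|"
proof -
  define step where "step X = X \<union> (\<Union>F\<in>Fpow X. \<phi> F)" for X
  define X where "X n = (step ^^ n) A" for n
  have X_Suc: "X (Suc n) = step (X n)" for n
    by (simp add: X_def)
  have card: "|X n| \<le>o |B|" for n
  proof (induction n)
    case 0
    then show ?case using A by (simp add: X_def)
  next
    case (Suc n)
    have "|\<Union>F\<in>Fpow (X n). \<phi> F| \<le>o |B|"
      using card_of_UNION_ordLeq_infinite[OF inf card_of_Fpow_ordLeq_infinite[OF inf Suc]]
        countable_ordLeq_infinite[OF \<phi> inf] by blast
    then show ?case
      unfolding X_Suc step_def using inf Suc by (intro card_of_Un_ordLeq_infinite_Field) (simp_all add: Field_card_of card_of_card_order_on card_of_Card_order)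
  qed
  have "mono X"
    unfolding mono_iff_le_Suc X_Suc step_def by blast
  then have dir: "\<exists>u\<in>UNIV. X s \<subseteq> X u \<and> X t \<subseteq> X u" for s t
    by (metis UNIV_I mono_def nle_le)
  have "finitary_closure \<phi> A \<subseteq> (\<Union>n\<in>UNIV. X n)"
  proof (rule finitary_closure_least)
    show "A \<subseteq> (\<Union>n\<in>UNIV. X n)"
      using UN_upper[of 0 UNIV X] by (simp add: X_def)
    fix F assume F: "finite F" "F \<subseteq> (\<Union>n\<in>UNIV. X n)"
    then obtain n where "F \<subseteq> X n"
      using finite_subset_directed_UN[of UNIV X F] dir by auto
    then have "\<phi> F \<subseteq> X (Suc n)"
      using F(1) unfolding X_Suc step_def Fpow_def by blast
    then show "\<phi> F \<subseteq> (\<Union>n\<in>UNIV. X n)" by blast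
  qed
  moreover have "|\<Union>n\<in>UNIV. X n| \<le>o |B|"
    using card_of_UNION_ordLeq_infinite[OF inf, of "UNIV :: nat set" X] card inf
      countable_ordLeq_infinite[of "UNIV :: nat set" B] by simp
  ultimately show ?thesis
    using card_of_mono1 ordLeq_transitive by blast
qed

lemma weight_ordLeq: "topology_base X \<B> \<Longrightarrow> weight X \<le>o |\<B>|"
  using weight_attained[of X] by force

subsection \<open>Coordinates\<close>

text \<open>One embedding is fixed and coordinates are read off through \<open>h\<close>, rather
  than replacing \<open>K\<close> by its image. All spaces of the system are then subspaces of
  \<open>K\<close> and share its carrier type.\<close>

locale semi_Eberlein_embedding =
  fixes K :: "'a topology" and \<Gamma> :: "'g set" and h :: "'a \<Rightarrow> 'g \<Rightarrow> real"
  assumes compact_Hausdorff: "compact_Hausdorff K"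
    and embedding: "embedding_map K (powertop_real \<Gamma>) h"
    and dense: "K closure_of {x \<in> topspace K. h x \<in> c0 \<Gamma>} = topspace K"
begin

lemma homeo: "homeomorphic_map K (subtopology (powertop_real \<Gamma>) (h ` topspace K)) h"
  using embedding by (simp add: embedding_map_def)

lemma continuous_h: "continuous_map K (powertop_real \<Gamma>) h"
  using homeo by (metis homeomorphic_imp_continuous_map continuous_map_in_subtopology)

lemma h_extensional: "x \<in> topspace K \<Longrightarrow> h x \<in> extensional \<Gamma>"
  using continuous_map_image_subset_topspace[OF continuous_h] by (auto simp: PiE_def)

lemma continuous_coord: "\<gamma> \<in> \<Gamma> \<Longrightarrow> continuous_map K euclideanreal (\<lambda>x. h x \<gamma>)"
  using continuous_map_compose[OF continuous_h continuous_map_product_projection[of \<gamma> \<Gamma>]]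
  by (simp add: o_def)

lemma point_eqI:
  assumes "x \<in> topspace K" "y \<in> topspace K" "\<And>\<gamma>. \<gamma> \<in> \<Gamma> \<Longrightarrow> h x \<gamma> = h y \<gamma>"
  shows "x = y"
proof -
  have "h x = h y"
    using assms h_extensional by (meson extensionalityI)
  then show ?thesis
    using assms homeo by (meson homeomorphic_imp_injective_map inj_onD)
qed

text \<open>Openness is transported through the embedding; a basic box of the product constrains
  only finitely many coordinates, so one radius serves them all.\<close>

lemma coordinate_neighbourhood:
  assumes U: "openin K U" and x: "x \<in> U"
  obtains F e where "finite F" "F \<subseteq> \<Gamma>" "e > 0"
    "\<And>y. y \<in> topspace K \<Longrightarrow> (\<And>\<gamma>. \<gamma> \<in> F \<Longrightarrow> \<bar>h y \<gamma> - h x \<gamma>\<bar> < e) \<Longrightarrow> y \<in> U"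
proof -
  have UK: "U \<subseteq> topspace K" using U by (rule openin_subset)
  have "openin (subtopology (powertop_real \<Gamma>) (h ` topspace K)) (h ` U)"
    using homeo U by (meson homeomorphic_imp_open_map open_map_def)
  then obtain V where V: "openin (powertop_real \<Gamma>) V" "h ` U = V \<inter> h ` topspace K"
    by (auto simp: openin_subtopology)
  then have "h x \<in> V" using x by blast
  then obtain W where W: "finite {i \<in> \<Gamma>. W i \<noteq> UNIV}" "\<And>i. i \<in> \<Gamma> \<Longrightarrow> open (W i)"
    "h x \<in> Pi\<^sub>E \<Gamma> W" "Pi\<^sub>E \<Gamma> W \<subseteq> V"
    using V(1) unfolding openin_product_topology_alt by (auto simp flip: open_openin)
  define F where "F = {i \<in> \<Gamma>. W i \<noteq> UNIV}"
  have "\<exists>d>0. \<forall>z. \<bar>z - h x i\<bar> < d \<longrightarrow> z \<in> W i" if "i \<in> F" for i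
    using W(2,3) that unfolding F_def open_dist
    by (force simp: dist_real_def)
  then obtain d where d: "\<And>i. i \<in> F \<Longrightarrow> d i > 0"
    "\<And>i z. i \<in> F \<Longrightarrow> \<bar>z - h x i\<bar> < d i \<Longrightarrow> z \<in> W i"
    by metis
  \<comment> \<open>The extra element 1 keeps the minimum meaningful and positive when
    \<open>F\<close> is empty.\<close>
  define e where "e = Min (insert 1 (d ` F))"
  have F: "finite F" using W(1) by (simp add: F_def)
  have e: "e > 0" "\<And>i. i \<in> F \<Longrightarrow> e \<le> d i"
    using F d(1) by (auto simp: e_def)
  show thesis
  proof (rule that[OF F _ e(1)])
    show "F \<subseteq> \<Gamma>" by (auto simp: F_def)
    fix y assume y: "y \<in> topspace K" "\<And>\<gamma>. \<gamma> \<in> F \<Longrightarrow> \<bar>h y \<gamma> - h x \<gamma>\<bar> < e"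
    have "h y i \<in> W i" if "i \<in> \<Gamma>" for i
      using d(2)[of i "h y i"] y(2)[of i] e(2)[of i] that by (cases "i \<in> F") (auto simp: F_def)
    then have "h y \<in> Pi\<^sub>E \<Gamma> W"
      using h_extensional[OF y(1)] by (auto simp: PiE_def)
    then obtain u where "u \<in> U" "h y = h u"
      using W(4) V(2) y(1) by blast
    then show "y \<in> U"
      using homeo UK y(1) by (metis homeomorphic_imp_injective_map inj_onD subsetD)
  qed
qed

section \<open>Approximation on finitely many coordinates and compactness\<close>

lemma openin_coordinate_box:
  assumes "finite F" "F \<subseteq> \<Gamma>"
  shows "openin K {y \<in> topspace K. \<forall>\<gamma>\<in>F. \<bar>h y \<gamma> - v \<gamma>\<bar> < e}"
  using assms
proof (induction F)
  case (insert \<gamma> F)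
  have "{z. \<bar>z - v \<gamma>\<bar> < e} = {v \<gamma> - e <..< v \<gamma> + e}"
    by auto
  then have "openin euclideanreal {z. \<bar>z - v \<gamma>\<bar> < e}"
    by (metis open_greaterThanLessThan open_openin)
  then have "openin K {y \<in> topspace K. h y \<gamma> \<in> {z. \<bar>z - v \<gamma>\<bar> < e}}"
    using continuous_coord[of \<gamma>] insert.prems openin_continuous_map_preimage by blast
  then have "openin K ({y \<in> topspace K. h y \<gamma> \<in> {z. \<bar>z - v \<gamma>\<bar> < e}} \<inter>
      {y \<in> topspace K. \<forall>\<gamma>\<in>F. \<bar>h y \<gamma> - v \<gamma>\<bar> < e})"
    using insert by (intro openin_Int) auto
  then show ?case
    by (rule back_subst[of "openin K"]) auto
qed simp

lemma c0_approximation: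
  assumes "finite F" "F \<subseteq> \<Gamma>" "x \<in> topspace K" "e > 0"
  obtains c where "c \<in> topspace K" "h c \<in> c0 \<Gamma>" "\<And>\<gamma>. \<gamma> \<in> F \<Longrightarrow> \<bar>h c \<gamma> - h x \<gamma>\<bar> < e"
proof -
  have "x \<in> K closure_of {x \<in> topspace K. h x \<in> c0 \<Gamma>}"
    using dense assms by simp
  moreover have "x \<in> {y \<in> topspace K. \<forall>\<gamma>\<in>F. \<bar>h y \<gamma> - h x \<gamma>\<bar> < e}"
    using assms by simp
  ultimately obtain c where "c \<in> {x \<in> topspace K. h x \<in> c0 \<Gamma>}"
      "c \<in> {y \<in> topspace K. \<forall>\<gamma>\<in>F. \<bar>h y \<gamma> - h x \<gamma>\<bar> < e}"
    using openin_coordinate_box[OF assms(1,2)] unfolding in_closure_of by meson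
  then show thesis
    using that by blast
qed

text \<open>The image of a compact space is closed, phrased in coordinates. If no point had the
  coordinates \<open>v\<close>, the open sets \<open>U k\<close>, on which some coordinate stays
  away from \<open>v\<close>, would cover \<open>K\<close>; a finite subcover names finitely many
  coordinates and a radius for which approximation fails.\<close>

lemma point_of_approximable_coordinates:
  assumes approx: "\<And>F e. finite F \<Longrightarrow> F \<subseteq> \<Gamma> \<Longrightarrow> e > 0 \<Longrightarrow>
      \<exists>k\<in>topspace K. \<forall>\<gamma>\<in>F. \<bar>h k \<gamma> - v \<gamma>\<bar> < e"
  shows "\<exists>k\<in>topspace K. \<forall>\<gamma>\<in>\<Gamma>. h k \<gamma> = v \<gamma>"
proof (rule ccontr)
  assume "\<not> ?thesis"
  then obtain g where g: "\<And>k. k \<in> topspace K \<Longrightarrow> g k \<in> \<Gamma> \<and> h k (g k) \<noteq> v (g k)"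
    by metis
  \<comment> \<open>Half the gap is taken so that \<open>k\<close> satisfies the strict inequality
    defining \<open>U k\<close>.\<close>
  define d where "d k = \<bar>h k (g k) - v (g k)\<bar> / 2" for k
  define U where "U k = {x \<in> topspace K. h x (g k) \<in> {z. d k < \<bar>z - v (g k)\<bar>}}" for k
  have U: "openin K (U k)" if "k \<in> topspace K" for k
  proof -
    have "openin euclideanreal {z. d k < \<bar>z - v (g k)\<bar>}"
      unfolding open_openin[symmetric] by (intro open_Collect_less continuous_intros)
    then show ?thesis
      unfolding U_def using openin_continuous_map_preimage continuous_coord g[OF that] by blast
  qed
  have dpos: "d k > 0" if "k \<in> topspace K" for k
    using g[OF that] by (simp add: d_def)
  then have "topspace K \<subseteq> \<Union>(U ` topspace K)"
    by (fastforce simp: U_def d_def)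
  then obtain \<F> where "finite \<F>" "\<F> \<subseteq> U ` topspace K" "topspace K \<subseteq> \<Union>\<F>"
    using compact_Hausdorff U unfolding compact_Hausdorff_def compact_space_alt
    by (metis (no_types, lifting) imageE)
  then obtain T where T: "finite T" "T \<subseteq> topspace K" "topspace K \<subseteq> \<Union>(U ` T)"
    by (metis finite_subset_image)
  define e where "e = Min (insert 1 (d ` T))"
  have e: "e > 0" "\<And>k. k \<in> T \<Longrightarrow> e \<le> d k"
    using T dpos by (auto simp: e_def)
  obtain k where k: "k \<in> topspace K" "\<forall>\<gamma>\<in>g ` T. \<bar>h k \<gamma> - v \<gamma>\<bar> < e"
    using approx[of "g ` T" e] T g e by blast
  then obtain t where "t \<in> T" "k \<in> U t"
    using T by blast
  then show False
    using k(2) e(2)[of t] by (force simp: U_def)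
qed

text \<open>Since \<open>h\<close> is an embedding, \<open>K\<close> carries the initial topology of
  its coordinates.\<close>

lemma continuous_map_into_K:
  assumes f: "f ` topspace L \<subseteq> topspace K"
    and coord: "\<And>\<gamma>. \<gamma> \<in> \<Gamma> \<Longrightarrow> continuous_map L euclideanreal (\<lambda>y. h (f y) \<gamma>)"
  shows "continuous_map L K f"
proof -
  obtain g where g: "homeomorphic_maps K (subtopology (powertop_real \<Gamma>) (h ` topspace K)) h g"
    using homeo homeomorphic_map_maps by blast
  have "continuous_map L (subtopology (powertop_real \<Gamma>) (h ` topspace K)) (h \<circ> f)"
    using f coord h_extensional
    by (auto simp: continuous_map_in_subtopology continuous_map_componentwise)
  then have "continuous_map L K (g \<circ> (h \<circ> f))"
    using g continuous_map_compose by (meson homeomorphic_maps_def)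
  then show ?thesis
    by (rule continuous_map_eq) (use f g in \<open>auto simp: homeomorphic_maps_def\<close>)
qed

lemma countable_c0_support:
  assumes "h c \<in> c0 \<Gamma>"
  shows "countable {\<gamma> \<in> \<Gamma>. h c \<gamma> \<noteq> 0}"
proof -
  have "{\<gamma> \<in> \<Gamma>. h c \<gamma> \<noteq> 0} \<subseteq> (\<Union>n. {\<gamma> \<in> \<Gamma>. \<bar>h c \<gamma>\<bar> > inverse (real (Suc n))})"
  proof
    fix \<gamma> assume \<gamma>: "\<gamma> \<in> {\<gamma> \<in> \<Gamma>. h c \<gamma> \<noteq> 0}"
    then obtain n where "inverse (real (Suc n)) < \<bar>h c \<gamma>\<bar>"
      using reals_Archimedean[of "\<bar>h c \<gamma>\<bar>"] by auto
    with \<gamma> show "\<gamma> \<in> (\<Union>n. {\<gamma> \<in> \<Gamma>. \<bar>h c \<gamma>\<bar> > inverse (real (Suc n))})"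
      by blast
  qed
  moreover have "finite {\<gamma> \<in> \<Gamma>. \<bar>h c \<gamma>\<bar> > inverse (real (Suc n))}" for n
    using assms by (simp add: c0_def)
  then have "countable (\<Union>n. {\<gamma> \<in> \<Gamma>. \<bar>h c \<gamma>\<bar> > inverse (real (Suc n))})"
    by (intro countable_UN[OF countableI_type countable_finite])
  ultimately show ?thesis
    by (rule countable_subset)
qed

text \<open>Only the restrictions to the finite set \<open>F\<close> matter, and these lie in a
  separable metric space. For each rational point over \<open>F\<close> and each radius
  \<open>inverse (real (Suc n))\<close>, one nearby point of \<open>c0\<close> is chosen whenever
  there is one.\<close>

lemma countable_c0_dense_on_finite_coordinates:
  assumes F: "finite F" "F \<subseteq> \<Gamma>"
  shows "\<exists>D. countable D \<and> D \<subseteq> {c \<in> topspace K. h c \<in> c0 \<Gamma>} \<and>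
           (\<forall>x\<in>topspace K. \<forall>e>0. \<exists>d\<in>D. \<forall>\<gamma>\<in>F. \<bar>h d \<gamma> - h x \<gamma>\<bar> < e)"
proof -
  define P where "P q n c \<longleftrightarrow> c \<in> topspace K \<and> h c \<in> c0 \<Gamma> \<and>
      (\<forall>\<gamma>\<in>F. \<bar>h c \<gamma> - q \<gamma>\<bar> < inverse (real (Suc n)))" for q n c
  define I where "I = {(q, n). q \<in> F \<rightarrow>\<^sub>E \<rat> \<and> (\<exists>c. P q n c)}"
  define pick where "pick = (\<lambda>(q, n). SOME c. P q n c)"
  have pick: "P q n (pick (q, n))" if "(q, n) \<in> I" for q n
  proof -
    have "\<exists>c. P q n c"
      using that by (simp add: I_def)
    then show ?thesis
      unfolding pick_def prod.case by (rule someI_ex)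
  qed
  have "countable ((F \<rightarrow>\<^sub>E \<rat>) \<times> (UNIV :: nat set))"
    using F(1) by (intro countable_SIGMA countable_PiE countable_rat) auto
  then have "countable I"
    by (rule countable_subset[rotated]) (auto simp: I_def)
  then have "countable (pick ` I)"
    by simp
  moreover have "pick ` I \<subseteq> {c \<in> topspace K. h c \<in> c0 \<Gamma>}"
    using pick unfolding P_def by auto
  moreover have "\<exists>d\<in>pick ` I. \<forall>\<gamma>\<in>F. \<bar>h d \<gamma> - h x \<gamma>\<bar> < e" if x: "x \<in> topspace K" and e: "e > 0" for x e
  proof -
    \<comment> \<open>Three errors add up: from the chosen point to the rational point, from there
      to \<open>c\<close>, and from \<open>c\<close> to \<open>x\<close>.\<close>
    obtain n where n: "inverse (real (Suc n)) < e / 3"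
      using reals_Archimedean[of "e / 3"] e by auto
    let ?\<delta> = "inverse (real (Suc n))"
    have \<delta>: "?\<delta> > 0" by simp
    obtain c where c: "c \<in> topspace K" "h c \<in> c0 \<Gamma>" "\<And>\<gamma>. \<gamma> \<in> F \<Longrightarrow> \<bar>h c \<gamma> - h x \<gamma>\<bar> < ?\<delta>"
      using c0_approximation[OF F x \<delta>] by blast
    have "\<exists>r\<in>\<rat>. \<bar>h c \<gamma> - r\<bar> < ?\<delta>" for \<gamma>
    proof -
      obtain r where "r \<in> \<rat>" "h c \<gamma> < r" "r < h c \<gamma> + ?\<delta>"
        using Rats_dense_in_real[of "h c \<gamma>" "h c \<gamma> + ?\<delta>"] \<delta> by auto
      then show ?thesis by (intro bexI[of _ r]) auto
    qed
    then obtain q0 where q0: "\<And>\<gamma>. q0 \<gamma> \<in> \<rat>" "\<And>\<gamma>. \<bar>h c \<gamma> - q0 \<gamma>\<bar> < ?\<delta>"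
      by metis
    define q where "q = restrict q0 F"
    have "P q n c"
      using c q0 by (simp add: P_def q_def)
    then have I: "(q, n) \<in> I"
      using q0(1) by (auto simp: I_def q_def)
    have "\<bar>h (pick (q, n)) \<gamma> - h x \<gamma>\<bar> < e" if \<gamma>: "\<gamma> \<in> F" for \<gamma>
    proof -
      have "\<bar>h (pick (q, n)) \<gamma> - q0 \<gamma>\<bar> < ?\<delta>"
        using pick[OF I] \<gamma> by (simp add: P_def q_def)
      with c(3)[OF \<gamma>] q0(2)[of \<gamma>] n show ?thesis by linarith
    qed
    with I show ?thesis by blast
  qed
  ultimately show ?thesis
    by (intro exI[of _ "pick ` I"] conjI ballI allI impI)
qed

subsection \<open>Admissible sets of coordinates\<close>

definition supported :: "'g set \<Rightarrow> 'a set" where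
  "supported S = {x \<in> topspace K. \<forall>\<gamma>\<in>\<Gamma> - S. h x \<gamma> = 0}"

definition truncation_of :: "'g set \<Rightarrow> 'a \<Rightarrow> 'a \<Rightarrow> bool" where
  "truncation_of S x k \<longleftrightarrow> k \<in> topspace K \<and> (\<forall>\<gamma>\<in>\<Gamma>. h k \<gamma> = (if \<gamma> \<in> S then h x \<gamma> else 0))"

definition admissible :: "'g set \<Rightarrow> bool" where
  "admissible S \<longleftrightarrow> (\<forall>x\<in>topspace K. \<exists>k. truncation_of S x k)"

text \<open>The choice is harmless: two truncations of the same point have equal coordinates on
  \<open>\<Gamma>\<close> and coincide by \<open>point_eqI\<close>.\<close>

definition truncate :: "'g set \<Rightarrow> 'a \<Rightarrow> 'a" where
  "truncate S x = (SOME k. truncation_of S x k)"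

abbreviation supported_space :: "'g set \<Rightarrow> 'a topology" where
  "supported_space S \<equiv> subtopology K (supported S)"

text \<open>
  The operator \<open>\<phi>\<close> sends a finite \<open>F\<close> to the union of the supports of countably many
  points of \<open>c0 \<Gamma>\<close> whose restrictions to \<open>F\<close> are dense. If \<open>S\<close> is closed under \<open>\<phi>\<close>, those points
  themselves approximate \<open>x\<close> on \<open>S\<close> and \<open>0\<close> off \<open>S\<close>.
\<close>

lemma admissible_finitary:
  "\<exists>\<phi> :: 'g set \<Rightarrow> 'g set. (\<forall>F. countable (\<phi> F)) \<and>
     (\<forall>S. (\<forall>F. finite F \<longrightarrow> F \<subseteq> S \<longrightarrow> \<phi> F \<subseteq> S) \<longrightarrow> admissible S)"
proof -
  define Q where "Q F D \<longleftrightarrow> countable D \<and> D \<subseteq> {c \<in> topspace K. h c \<in> c0 \<Gamma>} \<and>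
      (\<forall>x\<in>topspace K. \<forall>e>0. \<exists>d\<in>D. \<forall>\<gamma>\<in>F. \<bar>h d \<gamma> - h x \<gamma>\<bar> < e)" for F D
  have "\<exists>D. Q F D" if "finite F" "F \<subseteq> \<Gamma>" for F
    unfolding Q_def using that by (rule countable_c0_dense_on_finite_coordinates)
  then obtain D where Q: "\<And>F. finite F \<Longrightarrow> F \<subseteq> \<Gamma> \<Longrightarrow> Q F (D F)"
    by metis
  have D: "countable (D F)" "D F \<subseteq> {c \<in> topspace K. h c \<in> c0 \<Gamma>}"
    "x \<in> topspace K \<Longrightarrow> e > 0 \<Longrightarrow> \<exists>d\<in>D F. \<forall>\<gamma>\<in>F. \<bar>h d \<gamma> - h x \<gamma>\<bar> < e"
    if "finite F" "F \<subseteq> \<Gamma>" for F x e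
    using Q[OF that] by (simp_all add: Q_def)
  \<comment> \<open>The default \<open>{}\<close> makes the value countable for every argument, also
    where \<open>D\<close> is unconstrained.\<close>
  define \<phi> where "\<phi> F = (if finite F \<and> F \<subseteq> \<Gamma> then \<Union>d\<in>D F. {\<gamma> \<in> \<Gamma>. h d \<gamma> \<noteq> 0} else {})" for F
  have "countable (\<phi> F)" for F
  proof (cases "finite F \<and> F \<subseteq> \<Gamma>")
    case True
    have "countable (\<Union>d\<in>D F. {\<gamma> \<in> \<Gamma>. h d \<gamma> \<noteq> 0})"
      using D(1,2)[of F] True by (intro countable_UN countable_c0_support) auto
    then show ?thesis using True by (simp add: \<phi>_def)
  next
    case False
    then have "\<phi> F = {}" unfolding \<phi>_def by (rule if_not_P)
    then show ?thesis by simp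
  qed
  moreover have "admissible S" if S: "\<And>F. finite F \<Longrightarrow> F \<subseteq> S \<Longrightarrow> \<phi> F \<subseteq> S" for S
    unfolding admissible_def
  proof
    fix x assume x: "x \<in> topspace K"
    have "\<exists>k\<in>topspace K. \<forall>\<gamma>\<in>\<Gamma>. h k \<gamma> = (if \<gamma> \<in> S then h x \<gamma> else 0)"
    proof (rule point_of_approximable_coordinates)
      fix F and e :: real assume F: "finite F" "F \<subseteq> \<Gamma>" and e: "e > 0"
      have F': "finite (F \<inter> S)" "F \<inter> S \<subseteq> \<Gamma>" using F by auto
      obtain d where d: "d \<in> D (F \<inter> S)" "\<forall>\<gamma>\<in>F \<inter> S. \<bar>h d \<gamma> - h x \<gamma>\<bar> < e"
        using D(3)[OF F' x e] by blast
      have "{\<gamma> \<in> \<Gamma>. h d \<gamma> \<noteq> 0} \<subseteq> \<phi> (F \<inter> S)"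
        using d(1) F' by (auto simp: \<phi>_def)
      also have "\<dots> \<subseteq> S"
        using S[OF F'(1)] by simp
      finally have "h d \<gamma> = 0" if "\<gamma> \<in> F - S" for \<gamma>
        using F that by blast
      then have "\<forall>\<gamma>\<in>F. \<bar>h d \<gamma> - (if \<gamma> \<in> S then h x \<gamma> else 0)\<bar> < e"
        using d(2) e by auto
      moreover have "d \<in> topspace K"
        using D(2)[OF F'] d(1) by blast
      ultimately show "\<exists>k\<in>topspace K. \<forall>\<gamma>\<in>F. \<bar>h k \<gamma> - (if \<gamma> \<in> S then h x \<gamma> else 0)\<bar> < e"
        by blast
    qed
    then show "\<exists>k. truncation_of S x k"
      unfolding truncation_of_def by blast
  qed
  ultimately show ?thesis
    by (intro exI[of _ \<phi>]) simp
qed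

section \<open>Truncation as a retraction onto the supported points\<close>

lemma topspace_supported: "topspace (supported_space S) = supported S"
  by (auto simp: supported_def)

lemma supported_subset: "supported S \<subseteq> topspace K"
  by (auto simp: supported_def)

lemma supported_mono: "S \<subseteq> T \<Longrightarrow> supported S \<subseteq> supported T"
  by (auto simp: supported_def)

lemma
  assumes "admissible S" "x \<in> topspace K"
  shows truncate_in_K: "truncate S x \<in> topspace K"
    and coord_truncate: "\<gamma> \<in> \<Gamma> \<Longrightarrow> h (truncate S x) \<gamma> = (if \<gamma> \<in> S then h x \<gamma> else 0)"
proof -
  have "\<exists>k. truncation_of S x k"
    using assms by (simp add: admissible_def)
  then have "truncation_of S x (truncate S x)"
    unfolding truncate_def by (rule someI_ex)
  then show "truncate S x \<in> topspace K"
    and "\<gamma> \<in> \<Gamma> \<Longrightarrow> h (truncate S x) \<gamma> = (if \<gamma> \<in> S then h x \<gamma> else 0)"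
    by (auto simp: truncation_of_def)
qed

lemma truncate_in_supported:
  "admissible S \<Longrightarrow> x \<in> topspace K \<Longrightarrow> truncate S x \<in> supported S"
  by (simp add: supported_def truncate_in_K coord_truncate)

lemma truncate_eq_self:
  assumes "admissible S" "x \<in> supported S"
  shows "truncate S x = x"
  using assms by (intro point_eqI) (auto simp: supported_def truncate_in_K coord_truncate)

lemma truncate_truncate:
  assumes "admissible S" "admissible T" "S \<subseteq> T" "x \<in> topspace K"
  shows "truncate S (truncate T x) = truncate S x"
  using assms by (intro point_eqI) (auto simp: truncate_in_K coord_truncate)

text \<open>Leaving \<open>A\<close> free covers both the retraction of all of \<open>K\<close> and
  the bonding maps, where \<open>A\<close> is a larger supported set.\<close>

lemma truncate_image:
  assumes "admissible S" "supported S \<subseteq> A" "A \<subseteq> topspace K"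
  shows "truncate S ` A = supported S"
proof
  show "truncate S ` A \<subseteq> supported S"
    using assms truncate_in_supported by blast
  show "supported S \<subseteq> truncate S ` A"
  proof
    fix x assume x: "x \<in> supported S"
    show "x \<in> truncate S ` A"
      using truncate_eq_self[OF assms(1) x] assms(2) x by (intro image_eqI[of _ _ x]) auto
  qed
qed

text \<open>Each coordinate of the truncated point is either a coordinate of the original point or
  constantly zero.\<close>

lemma continuous_truncate:
  assumes "admissible S"
  shows "continuous_map K (supported_space S) (truncate S)"
proof -
  have "continuous_map K K (truncate S)"
  proof (rule continuous_map_into_K)
    show "truncate S ` topspace K \<subseteq> topspace K"
      using assms truncate_in_K by blast
    fix \<gamma> assume \<gamma>: "\<gamma> \<in> \<Gamma>"
    have "continuous_map K euclideanreal (\<lambda>x. if \<gamma> \<in> S then h x \<gamma> else 0)"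
      using continuous_coord[OF \<gamma>] by simp
    then show "continuous_map K euclideanreal (\<lambda>x. h (truncate S x) \<gamma>)"
      by (rule continuous_map_eq) (simp add: coord_truncate assms \<gamma>)
  qed
  then show ?thesis
    using assms truncate_in_supported by (auto simp: continuous_map_in_subtopology)
qed

text \<open>The subspace is the continuous image of the compact space \<open>K\<close> under
  truncation.\<close>

lemma compact_Hausdorff_supported:
  assumes "admissible S"
  shows "compact_Hausdorff (supported_space S)"
proof -
  have "compactin (supported_space S) (truncate S ` topspace K)"
    using compact_Hausdorff
    by (intro image_compactin[OF _ continuous_truncate[OF assms]])
      (simp add: compact_Hausdorff_def compact_space_def)
  then have "compact_space (supported_space S)"
    using truncate_image[OF assms supported_subset]
    by (simp add: compact_space_def topspace_supported del: topspace_subtopology)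
  then show ?thesis
    using compact_Hausdorff by (simp add: compact_Hausdorff_def Hausdorff_space_subtopology)
qed

text \<open>The embedding restricts. For density, a neighbourhood of a supported point is pulled
  back along truncation, which fixes that point; the preimage contains a point \<open>c\<close> of
  \<open>c0\<close>. Truncating \<open>c\<close> returns to the neighbourhood and stays in
  \<open>c0\<close>, because coordinates are only kept or set to zero.\<close>

lemma semi_Eberlein_supported:
  assumes S: "admissible S"
  shows "semi_Eberlein TYPE('g) (supported_space S)"
proof -
  have "homeomorphic_map (subtopology K (supported S))
      (subtopology (subtopology (powertop_real \<Gamma>) (h ` topspace K)) (h ` supported S)) h"
  proof (rule homeomorphic_map_subtopologies[OF homeo])
    have "h ` topspace K \<subseteq> topspace (powertop_real \<Gamma>)"
      using continuous_map_image_subset_topspace[OF continuous_h] .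
    then show "h ` (topspace K \<inter> supported S) =
        topspace (subtopology (powertop_real \<Gamma>) (h ` topspace K)) \<inter> h ` supported S"
      using supported_subset[of S] unfolding topspace_subtopology by blast
  qed
  moreover have "h ` topspace K \<inter> h ` supported S = h ` supported S"
    using supported_subset[of S] by blast
  ultimately have "embedding_map (supported_space S) (powertop_real \<Gamma>) h"
    unfolding embedding_map_def topspace_supported by (simp add: subtopology_subtopology)
  moreover have "supported_space S closure_of {x \<in> topspace (supported_space S). h x \<in> c0 \<Gamma>} =
      topspace (supported_space S)"
  proof
    show "topspace (supported_space S) \<subseteq>
        supported_space S closure_of {x \<in> topspace (supported_space S). h x \<in> c0 \<Gamma>}"
    proof
      fix x assume x: "x \<in> topspace (supported_space S)"
      have "\<exists>y. y \<in> {x \<in> topspace (supported_space S). h x \<in> c0 \<Gamma>} \<and> y \<in> V"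
        if xV: "x \<in> V" and V: "openin (supported_space S) V" for V
      proof -
        let ?W = "{y \<in> topspace K. truncate S y \<in> V}"
        have W: "openin K ?W"
          using continuous_truncate[OF S] V by (rule openin_continuous_map_preimage)
        have xS: "x \<in> supported S" using x by (simp add: topspace_supported)
        then have "x \<in> ?W"
          using xV truncate_eq_self[OF S xS] supported_subset by auto
        moreover have "x \<in> K closure_of {x \<in> topspace K. h x \<in> c0 \<Gamma>}"
          using dense supported_subset xS by blast
        ultimately obtain c where "c \<in> {x \<in> topspace K. h x \<in> c0 \<Gamma>}" "c \<in> ?W"
          using W unfolding in_closure_of by meson
        then have c: "c \<in> topspace K" "h c \<in> c0 \<Gamma>" "truncate S c \<in> V"
          by auto
        let ?k = "truncate S c"
        have k: "?k \<in> supported S" "?k \<in> topspace K"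
          using c S by (simp_all add: truncate_in_supported truncate_in_K)
        have "finite {\<gamma> \<in> \<Gamma>. \<bar>h ?k \<gamma>\<bar> > e}" if "e > 0" for e
        proof (rule finite_subset)
          show "{\<gamma> \<in> \<Gamma>. \<bar>h ?k \<gamma>\<bar> > e} \<subseteq> {\<gamma> \<in> \<Gamma>. \<bar>h c \<gamma>\<bar> > e}"
            using that by (auto simp: coord_truncate[OF S c(1)] split: if_splits)
          show "finite {\<gamma> \<in> \<Gamma>. \<bar>h c \<gamma>\<bar> > e}"
            using c(2) that by (simp add: c0_def)
        qed
        moreover have "h ?k \<in> topspace (powertop_real \<Gamma>)"
          using continuous_map_image_subset_topspace[OF continuous_h] k(2) by blast
        ultimately have "h ?k \<in> c0 \<Gamma>"
          by (simp add: c0_def)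
        then show ?thesis
          using k c(3) by (auto simp: topspace_supported)
      qed
      then show "x \<in> supported_space S closure_of {x \<in> topspace (supported_space S). h x \<in> c0 \<Gamma>}"
        using x unfolding in_closure_of by blast
    qed
  qed (rule closure_of_subset_topspace)
  ultimately show ?thesis
    unfolding semi_Eberlein_def using compact_Hausdorff_supported[OF S] by blast
qed

text \<open>Coordinates outside \<open>S\<close> vanish on the subspace, so finitely many rational
  interval conditions on coordinates in \<open>S \<inter> \<Gamma>\<close> already give a base. Such
  conditions are finite subsets of \<open>I\<close>, whose number is bounded by
  \<open>B\<close>.\<close>

lemma weight_supported:
  assumes inf: "infinite B" and S: "|S| \<le>o |B|"
  shows "weight (supported_space S) \<le>o |B|"
proof -
  define box where "box P = {x \<in> supported S. \<forall>(\<gamma>, a, b)\<in>P. a < h x \<gamma> \<and> h x \<gamma> < b}"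
    for P :: "('g \<times> real \<times> real) set"
  define I where "I = (S \<inter> \<Gamma>) \<times> (\<rat> \<times> \<rat> :: (real \<times> real) set)"
  have "topology_base (supported_space S) (box ` Fpow I)"
    unfolding topology_base_def
  proof (intro conjI ballI allI impI)
    fix V assume "V \<in> box ` Fpow I"
    then obtain P where "P \<in> Fpow I" and V: "V = box P"
      by blast
    then have P: "finite P" "P \<subseteq> I"
      by (simp_all add: Fpow_def)
    have "openin K {x \<in> topspace K. \<forall>(\<gamma>, a, b)\<in>P. a < h x \<gamma> \<and> h x \<gamma> < b}"
      using P
    proof (induction P)
      case (insert p P)
      obtain \<gamma> a b where p: "p = (\<gamma>, a, b)" by (cases p)
      then have "\<gamma> \<in> \<Gamma>" using insert.prems by (auto simp: I_def)
      moreover have "openin euclideanreal {a<..<b}"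
        unfolding open_openin[symmetric] by simp
      ultimately have "openin K {x \<in> topspace K. h x \<gamma> \<in> {a<..<b}}"
        using continuous_coord openin_continuous_map_preimage by blast
      then have "openin K ({x \<in> topspace K. h x \<gamma> \<in> {a<..<b}} \<inter>
          {x \<in> topspace K. \<forall>(\<gamma>, a, b)\<in>P. a < h x \<gamma> \<and> h x \<gamma> < b})"
        using insert by (intro openin_Int) auto
      then show ?case
        by (rule back_subst[of "openin K"]) (auto simp: p)
    qed simp
    moreover have "V = {x \<in> topspace K. \<forall>(\<gamma>, a, b)\<in>P. a < h x \<gamma> \<and> h x \<gamma> < b} \<inter> supported S"
      using supported_subset[of S] unfolding V box_def by auto
    ultimately show "openin (supported_space S) V"
      unfolding openin_subtopology by blast
  next
    fix U x assume "openin (supported_space S) U \<and> x \<in> U"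
    then obtain V where V: "openin K V" "U = V \<inter> supported S" "x \<in> V" "x \<in> supported S"
      by (auto simp: openin_subtopology)
    obtain F e where F: "finite F" "F \<subseteq> \<Gamma>" and e: "e > 0"
      and nb: "\<And>y. y \<in> topspace K \<Longrightarrow> (\<And>\<gamma>. \<gamma> \<in> F \<Longrightarrow> \<bar>h y \<gamma> - h x \<gamma>\<bar> < e) \<Longrightarrow> y \<in> V"
      using coordinate_neighbourhood[OF V(1,3)] by blast
    have "\<exists>a\<in>\<rat>. h x \<gamma> - e < a \<and> a < h x \<gamma>" "\<exists>b\<in>\<rat>. h x \<gamma> < b \<and> b < h x \<gamma> + e" for \<gamma>
      using Rats_dense_in_real[of "h x \<gamma> - e" "h x \<gamma>"]
        Rats_dense_in_real[of "h x \<gamma>" "h x \<gamma> + e"] e by auto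
    then obtain a b where a: "\<And>\<gamma>. a \<gamma> \<in> \<rat>" "\<And>\<gamma>. h x \<gamma> - e < a \<gamma>" "\<And>\<gamma>. a \<gamma> < h x \<gamma>"
      and b: "\<And>\<gamma>. b \<gamma> \<in> \<rat>" "\<And>\<gamma>. h x \<gamma> < b \<gamma>" "\<And>\<gamma>. b \<gamma> < h x \<gamma> + e"
      by metis
    \<comment> \<open>Coordinates in \<open>F - S\<close> need no interval: they are zero at
      \<open>x\<close> and at every other supported point.\<close>
    define P where "P = (\<lambda>\<gamma>. (\<gamma>, a \<gamma>, b \<gamma>)) ` (F \<inter> S)"
    have "P \<in> Fpow I"
      using F a(1) b(1) by (auto simp: P_def I_def Fpow_def)
    moreover have "x \<in> box P"
      using V(4) a b by (auto simp: box_def P_def)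
    moreover have "box P \<subseteq> U"
    proof
      fix y assume y: "y \<in> box P"
      then have yS: "y \<in> supported S" by (simp add: box_def)
      have "y \<in> V"
      proof (rule nb)
        show "y \<in> topspace K" using yS supported_subset by blast
        fix \<gamma> assume \<gamma>: "\<gamma> \<in> F"
        show "\<bar>h y \<gamma> - h x \<gamma>\<bar> < e"
        proof (cases "\<gamma> \<in> S")
          case True
          then have "a \<gamma> < h y \<gamma>" "h y \<gamma> < b \<gamma>"
            using y \<gamma> by (auto simp: box_def P_def)
          then show ?thesis using a(2)[of \<gamma>] b(3)[of \<gamma>] by linarith
        next
          case False
          then have "h y \<gamma> = 0" "h x \<gamma> = 0"
            using yS V(4) \<gamma> F(2) by (auto simp: supported_def)
          then show ?thesis using e by simp
        qed
      qed
      then show "y \<in> U" using V(2) yS by blast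
    qed
    ultimately show "\<exists>V\<in>box ` Fpow I. x \<in> V \<and> V \<subseteq> U" by blast
  qed
  then have "weight (supported_space S) \<le>o |box ` Fpow I|"
    by (rule weight_ordLeq)
  also have "|box ` Fpow I| \<le>o |Fpow I|"
    by (rule card_of_image)
  also have "|Fpow I| \<le>o |B|"
  proof (rule card_of_Fpow_ordLeq_infinite[OF inf])
    have S\<Gamma>: "|S \<inter> \<Gamma>| \<le>o |B|"
      using card_of_mono1[of "S \<inter> \<Gamma>" S] S ordLeq_transitive by blast
    have rats: "|\<rat> \<times> \<rat> :: (real \<times> real) set| \<le>o |B|"
      by (intro countable_ordLeq_infinite countable_SIGMA countable_rat inf)
    show "|I| \<le>o |B|"
      unfolding I_def using inf
      by (intro card_of_Times_ordLeq_infinite_Field[OF _ S\<Gamma> rats])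
        (simp_all add: Field_card_of card_of_card_order_on card_of_Card_order)
  qed
  finally show ?thesis .
qed

subsection \<open>Inverse systems of supported subspaces\<close>

text \<open>The number of coordinates is thereby governed by the weight of \<open>K\<close> instead
  of the size of \<open>\<Gamma>\<close>. One coordinate is picked for each pair of basic sets that
  some coordinate separates; distinct points lie in such a pair, taken inside two small
  neighbourhoods.\<close>

lemma separating_coordinates:
  assumes \<B>: "topology_base K \<B>"
  obtains S where "|S| \<le>o |\<B> \<times> \<B>|"
    "\<And>x y. x \<in> topspace K \<Longrightarrow> y \<in> topspace K \<Longrightarrow>
        (\<And>\<gamma>. \<gamma> \<in> S \<Longrightarrow> \<gamma> \<in> \<Gamma> \<Longrightarrow> h x \<gamma> = h y \<gamma>) \<Longrightarrow> x = y"
proof -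
  define sep where "sep U V \<gamma> \<longleftrightarrow> \<gamma> \<in> \<Gamma> \<and> (\<forall>u\<in>U. \<forall>v\<in>V. h u \<gamma> \<noteq> h v \<gamma>)" for U V \<gamma>
  \<comment> \<open>Pairs without a separating coordinate receive an arbitrary value, possibly
    outside \<open>\<Gamma>\<close>; hence the guard \<open>\<gamma> \<in> \<Gamma>\<close> in the
    conclusion.\<close>
  define pick where "pick = (\<lambda>(U, V). SOME \<gamma>. sep U V \<gamma>)"
  have base: "\<exists>W\<in>\<B>. x \<in> W \<and> W \<subseteq> U" if "openin K U" "x \<in> U" for U x
    using \<B> that by (simp add: topology_base_def)
  have "x = y" if x: "x \<in> topspace K" and y: "y \<in> topspace K"
    and eq: "\<And>\<gamma>. \<gamma> \<in> pick ` (\<B> \<times> \<B>) \<Longrightarrow> \<gamma> \<in> \<Gamma> \<Longrightarrow> h x \<gamma> = h y \<gamma>" for x y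
  proof (rule ccontr)
    assume "x \<noteq> y"
    then obtain \<gamma> where \<gamma>: "\<gamma> \<in> \<Gamma>" "h x \<gamma> \<noteq> h y \<gamma>"
      using point_eqI x y by blast
    \<comment> \<open>With half the distance, the strict \<open>e\<close>-neighbourhoods of
      \<open>x\<close> and \<open>y\<close> share no value of the coordinate
      \<open>\<gamma>\<close>.\<close>
    define e where "e = \<bar>h x \<gamma> - h y \<gamma>\<bar> / 2"
    have e: "e > 0" using \<gamma>(2) by (simp add: e_def)
    define N where "N z = {w \<in> topspace K. \<forall>\<delta>\<in>{\<gamma>}. \<bar>h w \<delta> - h z \<delta>\<bar> < e}" for z
    have "openin K (N z)" for z
      unfolding N_def using \<gamma>(1) by (intro openin_coordinate_box) auto
    moreover have "x \<in> N x" "y \<in> N y"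
      using x y e by (simp_all add: N_def)
    ultimately obtain U V where UV: "U \<in> \<B>" "x \<in> U" "U \<subseteq> N x" "V \<in> \<B>" "y \<in> V" "V \<subseteq> N y"
      using base[of "N x" x] base[of "N y" y] by auto
    have "h u \<gamma> \<noteq> h v \<gamma>" if "u \<in> U" "v \<in> V" for u v
    proof -
      have "\<bar>h u \<gamma> - h x \<gamma>\<bar> < e" "\<bar>h v \<gamma> - h y \<gamma>\<bar> < e"
        using UV(3,6) that by (auto simp: N_def)
      then show ?thesis unfolding e_def by argo
    qed
    then have "sep U V \<gamma>"
      using \<gamma>(1) by (simp add: sep_def)
    then have "sep U V (pick (U, V))"
      unfolding pick_def prod.case by (rule someI)
    then show False
      using eq[of "pick (U, V)"] UV by (auto simp: sep_def)
  qed
  then show thesis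
    using that[of "pick ` (\<B> \<times> \<B>)"] card_of_image by blast
qed

text \<open>A cone gives, over each point of its vertex, points of \<open>K\<close> whose
  coordinates agree wherever two index sets overlap. They glue to one family of coordinates on
  \<open>U\<close>, extended by zero. Compactness realizes this family by a point of
  \<open>K\<close>, and coordinates determine that point.\<close>

lemma inverse_limit_supported:
  fixes R :: "'i rel" and S :: "'i \<Rightarrow> 'g set"
  assumes dir: "up_directed R (Field R)" and mono: "\<And>s t. (s, t) \<in> R \<Longrightarrow> S s \<subseteq> S t"
    and adm: "\<And>s. s \<in> Field R \<Longrightarrow> admissible (S s)"
    and U: "U = (\<Union>s\<in>Field R. S s)" and admU: "admissible U"
  shows "inverse_limit R (\<lambda>s. supported_space (S s)) (\<lambda>s t. truncate (S s))
           (supported_space U) (\<lambda>s. truncate (S s))"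
proof -
  have cone: "system_cone R (\<lambda>s. supported_space (S s)) (\<lambda>s t. truncate (S s))
      (supported_space U) (\<lambda>s. truncate (S s))"
    unfolding system_cone_def
  proof (intro conjI ballI)
    show "compact_Hausdorff (supported_space U)"
      using admU by (rule compact_Hausdorff_supported)
    show "continuous_map (supported_space U) (supported_space (S s)) (truncate (S s))"
      if "s \<in> Field R" for s
      by (rule continuous_map_from_subtopology[OF continuous_truncate[OF adm[OF that]]])
    fix st assume "st \<in> R"
    then obtain s t where st: "st = (s, t)" "(s, t) \<in> R" by (cases st) auto
    then have "admissible (S s)" "admissible (S t)" "S s \<subseteq> S t"
      using adm mono by (auto simp: FieldI1 FieldI2)
    then show "case st of (s, t) \<Rightarrow>
        \<forall>x\<in>topspace (supported_space U). truncate (S s) x = truncate (S s) (truncate (S t) x)"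
      by (simp add: st(1) truncate_truncate)
  qed
  have "\<exists>f. cone_morphism R L q (supported_space U) (\<lambda>s. truncate (S s)) f \<and>
      (\<forall>g. cone_morphism R L q (supported_space U) (\<lambda>s. truncate (S s)) g \<longrightarrow>
           (\<forall>x\<in>topspace L. g x = f x))"
    if L: "system_cone R (\<lambda>s. supported_space (S s)) (\<lambda>s t. truncate (S s)) L q"
    for L :: "('i \<Rightarrow> 'a) topology" and q
  proof -
    have q_cont: "continuous_map L (supported_space (S s)) (q s)" if "s \<in> Field R" for s
      using L that by (simp add: system_cone_def)
    have q_coh: "q s y = truncate (S s) (q t y)" if "(s, t) \<in> R" "y \<in> topspace L" for s t y
      using L that by (auto simp: system_cone_def)
    have q_in: "q s y \<in> supported (S s)" if "s \<in> Field R" "y \<in> topspace L" for s y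
      using continuous_map_image_subset_topspace[OF q_cont[OF that(1)]] that(2)
      by (auto simp: topspace_supported)
    have q_K: "q s y \<in> topspace K" if "s \<in> Field R" "y \<in> topspace L" for s y
      using q_in[OF that] supported_subset by blast
    have coord_up: "h (q s y) \<gamma> = h (q t y) \<gamma>"
      if "(s, t) \<in> R" "y \<in> topspace L" "\<gamma> \<in> \<Gamma>" "\<gamma> \<in> S s" for s t y \<gamma>
    proof -
      have "admissible (S s)" "q t y \<in> topspace K"
        using that adm q_K by (auto simp: FieldI1 FieldI2)
      then show ?thesis
        using q_coh[OF that(1,2)] that by (simp add: coord_truncate)
    qed
    have coord_eq: "h (q s y) \<gamma> = h (q t y) \<gamma>"
      if st: "s \<in> Field R" "t \<in> Field R" and y\<gamma>: "y \<in> topspace L" "\<gamma> \<in> \<Gamma>" "\<gamma> \<in> S s" "\<gamma> \<in> S t"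
      for s t y \<gamma>
    proof -
      obtain u where "(s, u) \<in> R" "(t, u) \<in> R"
        using dir st unfolding up_directed_def by blast
      then show ?thesis using coord_up[of s u y \<gamma>] coord_up[of t u y \<gamma>] y\<gamma> by simp
    qed
    \<comment> \<open>Any index whose set contains \<open>\<gamma>\<close> would do, by
      \<open>coord_eq\<close>. Fixing one index per coordinate, independently of \<open>y\<close>,
      makes continuity of the glued coordinate immediate.\<close>
    define \<sigma> where "\<sigma> \<gamma> = (SOME s. s \<in> Field R \<and> \<gamma> \<in> S s)" for \<gamma>
    have \<sigma>: "\<sigma> \<gamma> \<in> Field R" "\<gamma> \<in> S (\<sigma> \<gamma>)" if "\<gamma> \<in> U" for \<gamma>
    proof -
      have "\<exists>s. s \<in> Field R \<and> \<gamma> \<in> S s" using that U by blast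
      then have "\<sigma> \<gamma> \<in> Field R \<and> \<gamma> \<in> S (\<sigma> \<gamma>)"
        unfolding \<sigma>_def by (rule someI_ex)
      then show "\<sigma> \<gamma> \<in> Field R" "\<gamma> \<in> S (\<sigma> \<gamma>)" by auto
    qed
    define v where "v y \<gamma> = (if \<gamma> \<in> U then h (q (\<sigma> \<gamma>) y) \<gamma> else 0)" for y \<gamma>
    have S_dir: "\<exists>u\<in>Field R. S s \<subseteq> S u \<and> S t \<subseteq> S u" if "s \<in> Field R" "t \<in> Field R" for s t
    proof -
      obtain u where "u \<in> Field R" "(s, u) \<in> R" "(t, u) \<in> R"
        using dir \<open>s \<in> Field R\<close> \<open>t \<in> Field R\<close> unfolding up_directed_def by blast
      then show ?thesis using mono by (intro bexI[of _ u]) auto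
    qed
    have ne: "Field R \<noteq> {}" using dir by (simp add: up_directed_def)
    have "\<exists>k\<in>topspace K. \<forall>\<gamma>\<in>\<Gamma>. h k \<gamma> = v y \<gamma>" if y: "y \<in> topspace L" for y
    proof (rule point_of_approximable_coordinates)
      fix F and e :: real assume F: "finite F" "F \<subseteq> \<Gamma>" and e: "e > 0"
      \<comment> \<open>By directedness a single \<open>q s y\<close> has exactly the prescribed
        coordinates on \<open>F\<close>: those in \<open>U\<close> are already in
        \<open>S s\<close>, and the others vanish.\<close>
      obtain s where s: "s \<in> Field R" "F \<inter> U \<subseteq> S s"
        using finite_subset_directed_UN[OF ne S_dir, of "F \<inter> U"] F(1) U by auto
      have "h (q s y) \<gamma> = v y \<gamma>" if \<gamma>: "\<gamma> \<in> F" for \<gamma>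
      proof (cases "\<gamma> \<in> U")
        case True
        then show ?thesis
          using coord_eq[of s "\<sigma> \<gamma>" y \<gamma>] \<sigma>[OF True] s \<gamma> F(2) y by (auto simp: v_def)
      next
        case False
        then have "\<gamma> \<notin> S s" using s(1) U by blast
        then have "h (q s y) \<gamma> = 0"
          using q_in[OF s(1) y] \<gamma> F(2) by (auto simp: supported_def)
        with False show ?thesis by (simp add: v_def)
      qed
      then show "\<exists>k\<in>topspace K. \<forall>\<gamma>\<in>F. \<bar>h k \<gamma> - v y \<gamma>\<bar> < e"
        using q_K[OF s(1) y] e by (intro bexI[of _ "q s y"]) auto
    qed
    then obtain f where f: "\<And>y. y \<in> topspace L \<Longrightarrow> f y \<in> topspace K"
      "\<And>y \<gamma>. y \<in> topspace L \<Longrightarrow> \<gamma> \<in> \<Gamma> \<Longrightarrow> h (f y) \<gamma> = v y \<gamma>"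
      by metis
    have "continuous_map L K f"
    proof (rule continuous_map_into_K)
      show "f ` topspace L \<subseteq> topspace K" using f(1) by blast
      fix \<gamma> assume \<gamma>: "\<gamma> \<in> \<Gamma>"
      have "continuous_map L euclideanreal (\<lambda>y. v y \<gamma>)"
      proof (cases "\<gamma> \<in> U")
        case True
        have "continuous_map L K (q (\<sigma> \<gamma>))"
          using q_cont[OF \<sigma>(1)[OF True]] by (simp add: continuous_map_in_subtopology)
        then have "continuous_map L euclideanreal ((\<lambda>x. h x \<gamma>) \<circ> q (\<sigma> \<gamma>))"
          using continuous_coord[OF \<gamma>] by (rule continuous_map_compose)
        then show ?thesis using True by (simp add: v_def o_def)
      next
        case False
        then show ?thesis by (simp add: v_def)
      qed
      then show "continuous_map L euclideanreal (\<lambda>y. h (f y) \<gamma>)"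
        by (rule continuous_map_eq) (simp add: f(2) \<gamma>)
    qed
    moreover have "f ` topspace L \<subseteq> supported U"
      using f by (auto simp: supported_def v_def)
    ultimately have f_cont: "continuous_map L (supported_space U) f"
      by (auto simp: continuous_map_in_subtopology)
    have f_q: "q s y = truncate (S s) (f y)" if s: "s \<in> Field R" and y: "y \<in> topspace L" for s y
    proof (rule point_eqI)
      show "q s y \<in> topspace K" using s y by (rule q_K)
      show "truncate (S s) (f y) \<in> topspace K"
        using adm[OF s] f(1)[OF y] by (rule truncate_in_K)
      fix \<gamma> assume \<gamma>: "\<gamma> \<in> \<Gamma>"
      show "h (q s y) \<gamma> = h (truncate (S s) (f y)) \<gamma>"
      proof (cases "\<gamma> \<in> S s")
        case True
        then have \<gamma>U: "\<gamma> \<in> U" using s U by blast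
        then show ?thesis
          using coord_eq[OF s \<sigma>(1)[OF \<gamma>U] y \<gamma> True \<sigma>(2)[OF \<gamma>U]] True
          by (simp add: coord_truncate adm s f y \<gamma> v_def)
      next
        case False
        then show ?thesis
          using q_in[OF s y] by (simp add: coord_truncate adm s f y \<gamma> supported_def)
      qed
    qed
    \<comment> \<open>The coordinates of \<open>g y\<close> are forced: in \<open>U\<close> by the
      projection with index \<open>\<sigma> \<gamma>\<close>, outside \<open>U\<close> by the
      support condition.\<close>
    have "g y = f y" if g: "cone_morphism R L q (supported_space U) (\<lambda>s. truncate (S s)) g"
      and y: "y \<in> topspace L" for g y
    proof (rule point_eqI)
      have gc: "continuous_map L (supported_space U) g"
        using g by (simp add: cone_morphism_def)
      have gU: "g y \<in> supported U"
        using continuous_map_image_subset_topspace[OF gc] y by (auto simp: topspace_supported)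
      then show gK: "g y \<in> topspace K" using supported_subset by blast
      show "f y \<in> topspace K" using f(1) y .
      fix \<gamma> assume \<gamma>: "\<gamma> \<in> \<Gamma>"
      show "h (g y) \<gamma> = h (f y) \<gamma>"
      proof (cases "\<gamma> \<in> U")
        case True
        have "q (\<sigma> \<gamma>) y = truncate (S (\<sigma> \<gamma>)) (g y)"
          using g \<sigma>[OF True] y by (simp add: cone_morphism_def)
        then show ?thesis
          using True \<sigma>[OF True] by (simp add: coord_truncate adm gK \<gamma> f y v_def)
      next
        case False
        then show ?thesis
          using gU \<gamma> by (simp add: supported_def f y v_def)
      qed
    qed
    moreover have "cone_morphism R L q (supported_space U) (\<lambda>s. truncate (S s)) f"
      unfolding cone_morphism_def using f_cont f_q by simp
    ultimately show ?thesis by (intro exI[of _ f]) simp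
  qed
  then show ?thesis
    unfolding inverse_limit_def inverse_limit_wrt_def using cone by simp
qed

text \<open>Continuity at a supremum \<open>t\<close> is \<open>inverse_limit_supported\<close> for
  the system restricted to \<open>T\<close>; the assumption \<open>sup\<close> identifies
  \<open>S t\<close> with the required union.\<close>

lemma continuous_inverse_system_supported:
  fixes R :: "'i rel" and S :: "'i \<Rightarrow> 'g set"
  assumes R: "Partial_order R" and dir: "up_directed R (Field R)"
    and mono: "\<And>s t. (s, t) \<in> R \<Longrightarrow> S s \<subseteq> S t"
    and adm: "\<And>s. s \<in> Field R \<Longrightarrow> admissible (S s)"
    and sup: "\<And>T t. up_directed R T \<Longrightarrow> is_supremum R T t \<Longrightarrow> S t = (\<Union>s\<in>T. S s)"
  shows "continuous_inverse_system R (\<lambda>s. supported_space (S s)) (\<lambda>s t. truncate (S s))"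
proof -
  have sys: "inverse_system R (\<lambda>s. supported_space (S s)) (\<lambda>s t. truncate (S s))"
    unfolding inverse_system_def topspace_supported
  proof (intro conjI ballI allI impI)
    show "compact_Hausdorff (supported_space (S s))" if "s \<in> Field R" for s
      using adm[OF that] by (rule compact_Hausdorff_supported)
    show "truncate (S s) x = x" if "s \<in> Field R" "x \<in> supported (S s)" for s x
      using adm[OF that(1)] that(2) by (rule truncate_eq_self)
    show "truncate (S s) x = truncate (S s) (truncate (S t) x)"
      if "(s, t) \<in> R \<and> (t, u) \<in> R" "x \<in> supported (S u)" for s t u x
    proof -
      have "admissible (S s)" "admissible (S t)" "S s \<subseteq> S t" "x \<in> topspace K"
        using that adm mono subsetD[OF supported_subset] by (auto simp: FieldI1 FieldI2)
      then show ?thesis by (simp add: truncate_truncate)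
    qed
    fix st assume "st \<in> R"
    then obtain s t where st: "st = (s, t)" "(s, t) \<in> R" by (cases st) auto
    then have s: "admissible (S s)" "S s \<subseteq> S t"
      using adm mono by (auto simp: FieldI1)
    have "truncate (S s) ` supported (S t) = supported (S s)"
      using s by (intro truncate_image supported_mono supported_subset)
    moreover have "continuous_map (supported_space (S t)) (supported_space (S s)) (truncate (S s))"
      by (rule continuous_map_from_subtopology[OF continuous_truncate[OF s(1)]])
    ultimately show "case st of (s, t) \<Rightarrow>
        continuous_map (supported_space (S t)) (supported_space (S s)) (truncate (S s)) \<and>
        truncate (S s) ` supported (S t) = supported (S s)"
      by (simp add: st(1))
  qed (fact R dir)+
  have "inverse_limit (Restr R T) (\<lambda>s. supported_space (S s)) (\<lambda>s t. truncate (S s))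
      (supported_space (S t)) (\<lambda>s. truncate (S s))"
    if T: "up_directed R T" and t: "is_supremum R T t" for T t
  proof (rule inverse_limit_supported)
    have F: "Field (Restr R T) = T" and "inverse_system (Restr R T)
        (\<lambda>s. supported_space (S s)) (\<lambda>s t. truncate (S s))"
      using inverse_system_Restr[OF sys T] .
    then show "up_directed (Restr R T) (Field (Restr R T))"
      by (simp add: inverse_system_def)
    show "S s \<subseteq> S t" if "(s, t) \<in> Restr R T" for s t
      using that mono by blast
    have TF: "T \<subseteq> Field R" using T by (simp add: up_directed_def)
    show "admissible (S s)" if "s \<in> Field (Restr R T)" for s
      using that F TF adm by blast
    show "S t = (\<Union>s\<in>Field (Restr R T). S s)"
      using sup[OF T t] F by simp
    have "t \<in> Field R" using t by (simp add: is_supremum_def Above_def)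
    then show "admissible (S t)" by (rule adm)
  qed
  with sys show ?thesis
    by (simp add: continuous_inverse_system_def)
qed

text \<open>The inclusion of the smaller supported set is the right inverse.\<close>

lemma retraction_map_truncate:
  assumes "admissible S" "S \<subseteq> T"
  shows "retraction_map (supported_space T) (supported_space S) (truncate S)"
  unfolding retraction_map_def retraction_maps_def
proof (intro exI[of _ id] conjI ballI)
  show "continuous_map (supported_space T) (supported_space S) (truncate S)"
    by (rule continuous_map_from_subtopology[OF continuous_truncate[OF assms(1)]])
  show "continuous_map (supported_space S) (supported_space T) id"
    using supported_mono[OF assms(2)]
    by (auto simp: continuous_map_in_subtopology intro: continuous_map_from_subtopology)
  show "truncate S (id x) = x" if "x \<in> topspace (supported_space S)" for x
    using that assms(1) by (simp add: topspace_supported truncate_eq_self del: topspace_subtopology)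
qed

end

section \<open>Chains of coordinate sets along a cardinal\<close>

lemma is_supremum_underS:
  assumes R: "Well_order R" and t: "is_supremum R T t" and T: "T \<subseteq> Field R" "t \<notin> T"
  shows "underS R t = (\<Union>s\<in>T. underS R s)"
proof
  have ord: "refl_on (Field R) R" "trans R" "antisym R" "total_on (Field R) R"
    using R by (auto simp: order_on_defs)
  have tF: "t \<in> Field R" and above: "\<And>s. s \<in> T \<Longrightarrow> (s, t) \<in> R"
    and least: "\<And>u. u \<in> Above R T \<Longrightarrow> (t, u) \<in> R"
    using t by (auto simp: is_supremum_def Above_def)
  show "(\<Union>s\<in>T. underS R s) \<subseteq> underS R t"
    using above ord(2,3) T(2) unfolding underS_def by (auto dest: transD antisymD)
  show "underS R t \<subseteq> (\<Union>s\<in>T. underS R s)"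
  proof
    fix u assume u: "u \<in> underS R t"
    then have uF: "u \<in> Field R" by (auto simp: underS_def Field_def)
    \<comment> \<open>An element strictly below the supremum cannot bound \<open>T\<close>; by
      linearity it then lies strictly below some member of \<open>T\<close>.\<close>
    have "u \<notin> Above R T"
      using u least[of u] ord(3) by (auto simp: underS_def dest: antisymD)
    then obtain s where s: "s \<in> T" "(s, u) \<notin> R"
      using uF by (auto simp: Above_def)
    then have "u \<noteq> s" using ord(1) uF by (auto dest: refl_onD)
    then have "(u, s) \<in> R"
      using ord(4) s T(1) uF by (auto simp: total_on_def)
    with s(1) \<open>u \<noteq> s\<close> show "u \<in> (\<Union>s\<in>T. underS R s)" by (auto simp: underS_def)
  qed
qed

theorem theorem2p4:
  fixes K :: "'a topology" and \<kappa> :: "'i rel"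
  assumes "semi_Eberlein TYPE('g) K"
    and "topspace K \<noteq> {}"
    and "Card_order \<kappa>"
    and "weight K =o \<kappa>"
  shows "\<exists>(Ks :: 'i \<Rightarrow> 'a topology) r.
           continuous_inverse_system \<kappa> Ks r \<and>
           (\<exists>\<pi>. inverse_limit \<kappa> Ks r K \<pi>) \<and>
           (\<forall>(\<alpha>, \<beta>)\<in>\<kappa>. retraction_map (Ks \<beta>) (Ks \<alpha>) (r \<alpha> \<beta>)) \<and>
           (\<forall>\<alpha>\<in>Field \<kappa>. semi_Eberlein TYPE('g) (Ks \<alpha>) \<and>
              (weight (Ks \<alpha>) \<le>o natLeq \<or> weight (Ks \<alpha>) \<le>o |underS \<kappa> \<alpha>| ))"
proof -
  obtain \<Gamma> :: "'g set" and h where "semi_Eberlein_embedding K \<Gamma> h"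
    using assms(1) unfolding semi_Eberlein_def semi_Eberlein_embedding_def by blast
  then interpret semi_Eberlein_embedding K \<Gamma> h .
  have wo: "Well_order \<kappa>"
    using assms(3) by (rule Card_order_wo_rel[unfolded wo_rel_def])
  then have ord: "Partial_order \<kappa>" "refl_on (Field \<kappa>) \<kappa>" "trans \<kappa>" "antisym \<kappa>" "total_on (Field \<kappa>) \<kappa>"
    by (auto simp: order_on_defs)
  obtain \<B> where \<B>: "topology_base K \<B>" "weight K = |\<B>|"
    using weight_attained by blast
  have \<B>_le: "|\<B>| \<le>o \<kappa>"
    using assms(4) \<B>(2) ordIso_imp_ordLeq by simp
  obtain S\<^sub>0 where S\<^sub>0: "|S\<^sub>0| \<le>o |\<B> \<times> \<B>|"
    and sep: "\<And>x y. x \<in> topspace K \<Longrightarrow> y \<in> topspace K \<Longrightarrow>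
        (\<And>\<gamma>. \<gamma> \<in> S\<^sub>0 \<Longrightarrow> \<gamma> \<in> \<Gamma> \<Longrightarrow> h x \<gamma> = h y \<gamma>) \<Longrightarrow> x = y"
    using separating_coordinates[OF \<B>(1)] by blast
  have F\<kappa>: "\<kappa> =o |Field \<kappa>|"
    using card_of_Field_ordIso[OF assms(3)] by (rule ordIso_symmetric)
  have \<B>_Field: "|\<B>| \<le>o |Field \<kappa>|"
    using \<B>_le F\<kappa> by (rule ordLeq_ordIso_trans)
  \<comment> \<open>Nonemptiness of \<open>K\<close> enters here: it makes the index set nonempty,
    as directedness demands.\<close>
  have "\<B> \<noteq> {}"
    using \<B>(1) assms(2) openin_topspace[of K] unfolding topology_base_def by blast
  then have ne: "Field \<kappa> \<noteq> {}"
    using \<B>_Field card_of_empty3[of \<B>] by auto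
  have dir: "up_directed \<kappa> (Field \<kappa>)"
    unfolding up_directed_def
  proof (intro conjI ballI)
    fix s t assume st: "s \<in> Field \<kappa>" "t \<in> Field \<kappa>"
    then have refl: "(s, s) \<in> \<kappa>" "(t, t) \<in> \<kappa>"
      using ord(2) by (auto dest: refl_onD)
    moreover have "(s, t) \<in> \<kappa> \<or> (t, s) \<in> \<kappa>"
      using ord(5) st refl(1) unfolding total_on_def by (cases "s = t") auto
    ultimately show "\<exists>u\<in>Field \<kappa>. (s, u) \<in> \<kappa> \<and> (t, u) \<in> \<kappa>" using st by blast
  qed (use ne in auto)
  \<comment> \<open>These are the chains before closing under the operator. Finite members form a
    separate case of the size bound because their closures are countable, which matches the bound by
    \<omega>.\<close>
  obtain A where A_mono: "\<And>s t. (s, t) \<in> \<kappa> \<Longrightarrow> A s \<subseteq> A t"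
    and A_sup: "\<And>T t. up_directed \<kappa> T \<Longrightarrow> is_supremum \<kappa> T t \<Longrightarrow> A t = (\<Union>s\<in>T. A s)"
    and A_un: "S\<^sub>0 = (\<Union>s\<in>Field \<kappa>. A s)"
    and A_card: "\<And>s. s \<in> Field \<kappa> \<Longrightarrow> finite (A s) \<or> |A s| \<le>o |underS \<kappa> s|"
  proof (cases "finite (Field \<kappa>)")
    case True
    then have "finite \<B>"
      using \<B>_Field card_of_ordLeq_finite by blast
    then have "finite S\<^sub>0"
      using S\<^sub>0 card_of_ordLeq_finite by blast
    then show thesis
      using ne by (intro that[of "\<lambda>_. S\<^sub>0"]) (auto simp: up_directed_def)
  next
    case False
    have "|\<B> \<times> \<B>| \<le>o \<kappa>"
      using card_of_Times_ordLeq_infinite_Field[OF False \<B>_le \<B>_le assms(3)] .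
    then have "|S\<^sub>0| \<le>o |Field \<kappa>|"
      using S\<^sub>0 F\<kappa> by (blast intro: ordLeq_transitive ordLeq_ordIso_trans)
    then obtain g where g: "inj_on g S\<^sub>0" "g ` S\<^sub>0 \<subseteq> Field \<kappa>"
      unfolding card_of_ordLeq[symmetric] by blast
    \<comment> \<open>Strict predecessors make the chain continuous at limits and bound
      \<open>A s\<close> by \<open>underS \<kappa> s\<close>. They still exhaust
      \<open>S\<^sub>0\<close>, since an infinite cardinal has no last element.\<close>
    define A where "A s = {\<gamma> \<in> S\<^sub>0. g \<gamma> \<in> underS \<kappa> s}" for s
    show thesis
    proof (rule that[of A])
      show mono: "A s \<subseteq> A t" if "(s, t) \<in> \<kappa>" for s t
        using that ord(3,4) by (auto simp: A_def underS_def dest: transD antisymD)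
      show "A t = (\<Union>s\<in>T. A s)" if T: "up_directed \<kappa> T" and t: "is_supremum \<kappa> T t" for T t
      proof (cases "t \<in> T")
        case True
        moreover have "A s \<subseteq> A t" if "s \<in> T" for s
          using t that by (intro mono) (auto simp: is_supremum_def Above_def)
        ultimately show ?thesis by blast
      next
        case False
        have "underS \<kappa> t = (\<Union>s\<in>T. underS \<kappa> s)"
          using wo t _ False by (rule is_supremum_underS) (use T in \<open>simp add: up_directed_def\<close>)
        then show ?thesis by (auto simp: A_def)
      qed
      show "S\<^sub>0 = (\<Union>s\<in>Field \<kappa>. A s)"
      proof
        show "S\<^sub>0 \<subseteq> (\<Union>s\<in>Field \<kappa>. A s)"
        proof
          fix \<gamma> assume \<gamma>: "\<gamma> \<in> S\<^sub>0"
          then obtain b where "b \<in> Field \<kappa>" "g \<gamma> \<noteq> b" "(g \<gamma>, b) \<in> \<kappa>"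
            using infinite_Card_order_limit[OF assms(3) False, of "g \<gamma>"] g(2) by blast
          with \<gamma> show "\<gamma> \<in> (\<Union>s\<in>Field \<kappa>. A s)" by (auto simp: A_def underS_def)
        qed
      qed (auto simp: A_def)
      show "finite (A s) \<or> |A s| \<le>o |underS \<kappa> s|" if "s \<in> Field \<kappa>" for s
      proof -
        have "inj_on g (A s)" "g ` A s \<subseteq> underS \<kappa> s"
          using g(1) by (auto simp: A_def inj_on_def)
        then show ?thesis
          unfolding card_of_ordLeq[symmetric] by blast
      qed
    qed
  qed
  obtain \<phi> :: "'g set \<Rightarrow> 'g set" where \<phi>: "\<And>F. countable (\<phi> F)"
    and adm_\<phi>: "\<And>S. (\<And>F. finite F \<Longrightarrow> F \<subseteq> S \<Longrightarrow> \<phi> F \<subseteq> S) \<Longrightarrow> admissible S"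
    using admissible_finitary by auto
  define S where "S s = finitary_closure \<phi> (A s)" for s
  have adm: "admissible (finitary_closure \<phi> B)" for B
    by (intro adm_\<phi> finitary_closure_closed)
  have S_UN: "finitary_closure \<phi> (\<Union>s\<in>T. A s) = (\<Union>s\<in>T. S s)" if T: "up_directed \<kappa> T" for T
    unfolding S_def
  proof (rule finitary_closure_directed_UN)
    show "T \<noteq> {}" using T by (simp add: up_directed_def)
    fix s t assume "s \<in> T" "t \<in> T"
    then obtain u where "u \<in> T" "(s, u) \<in> \<kappa>" "(t, u) \<in> \<kappa>"
      using T unfolding up_directed_def by blast
    then show "\<exists>u\<in>T. A s \<subseteq> A u \<and> A t \<subseteq> A u"
      using A_mono by (intro bexI[of _ u]) auto
  qed
  have S_mono: "S s \<subseteq> S t" if "(s, t) \<in> \<kappa>" for s t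
    unfolding S_def by (intro finitary_closure_mono A_mono that)
  define U where "U = finitary_closure \<phi> S\<^sub>0"
  have U: "U = (\<Union>s\<in>Field \<kappa>. S s)"
    unfolding U_def A_un using dir by (rule S_UN)
  have S\<^sub>0_U: "S\<^sub>0 \<subseteq> U"
    unfolding U_def by (rule finitary_closure_subset)
  have admU: "admissible U" and admS: "admissible (S s)" for s
    unfolding U_def S_def by (rule adm)+
  \<comment> \<open>Truncation to \<open>U\<close> keeps every coordinate in
    \<open>S\<^sub>0\<close>, and these separate points, so it is the identity on \<open>K\<close>.
    The limit space is therefore \<open>K\<close> itself.\<close>
  have "x \<in> supported U" if x: "x \<in> topspace K" for x
  proof -
    have "truncate U x = x"
    proof (rule sep)
      show "truncate U x \<in> topspace K" using admU x by (rule truncate_in_K)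
      fix \<gamma> assume "\<gamma> \<in> S\<^sub>0" "\<gamma> \<in> \<Gamma>"
      then show "h (truncate U x) \<gamma> = h x \<gamma>"
        using subsetD[OF S\<^sub>0_U] by (simp add: coord_truncate admU x)
    qed (fact x)
    then show ?thesis
      using truncate_in_supported[OF admU x] by simp
  qed
  then have "supported U = topspace K"
    using supported_subset by blast
  then have "inverse_limit \<kappa> (\<lambda>s. supported_space (S s)) (\<lambda>s t. truncate (S s)) K (\<lambda>s. truncate (S s))"
    using inverse_limit_supported[OF dir S_mono admS U admU] by simp
  moreover have "continuous_inverse_system \<kappa> (\<lambda>s. supported_space (S s)) (\<lambda>s t. truncate (S s))"
  proof (rule continuous_inverse_system_supported[OF ord(1) dir S_mono admS])
    show "S t = (\<Union>s\<in>T. S s)" if T: "up_directed \<kappa> T" and t: "is_supremum \<kappa> T t" for T t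
      using S_UN[OF T] A_sup[OF T t] by (simp add: S_def)
  qed
  moreover have "retraction_map (supported_space (S t)) (supported_space (S s)) (truncate (S s))"
    if "(s, t) \<in> \<kappa>" for s t
    using admS S_mono[OF that] by (rule retraction_map_truncate)
  moreover have "semi_Eberlein TYPE('g) (supported_space (S s))" for s
    using admS by (rule semi_Eberlein_supported)
  moreover have "weight (supported_space (S s)) \<le>o natLeq \<or>
      weight (supported_space (S s)) \<le>o |underS \<kappa> s|" if s: "s \<in> Field \<kappa>" for s
  proof -
    \<comment> \<open>The bound is used with the natural numbers when \<open>A s\<close> is finite,
      and with the predecessors of \<open>s\<close> otherwise.\<close>
    have w: "weight (supported_space (S s)) \<le>o |B|" if "infinite B" "|A s| \<le>o |B|" for B :: "'b set"
      unfolding S_def using that by (intro weight_supported card_of_finitary_closure \<phi>)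
    show ?thesis
    proof (cases "finite (A s)")
      case True
      then have "weight (supported_space (S s)) \<le>o |UNIV :: nat set|"
        by (intro w countable_ordLeq_infinite countable_finite) auto
      then show ?thesis
        using card_of_nat ordLeq_ordIso_trans by blast
    next
      case False
      then have le: "|A s| \<le>o |underS \<kappa> s|" using A_card[OF s] by blast
      with False have "infinite (underS \<kappa> s)"
        using card_of_ordLeq_finite by blast
      then show ?thesis using w le by blast
    qed
  qed
  ultimately show ?thesis
    by (intro exI[of _ "\<lambda>s. supported_space (S s)"] exI[of _ "\<lambda>s t. truncate (S s)"]) auto
qed

end
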